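(* Let $\phi:[0,1]\to[0,1]$ be a nondecreasing continuous function such that $\phi(x)>x$ for all $x\in(0,1)$, and suppose that either $\phi(0)=0$ or $\phi(1-\varepsilon)\neq1$ for all $0<\varepsilon<1$. Let $V_\phi$ be the operator on $L_2[0,1]$ given by $(V_\phi f)(x)=\int_0^{\phi(x)}f(t)\,dt$. Then (1) $\sigma_p(V_\phi)\setminus\{0\}=\{\lambda_1,\lambda_2,\dots\}$ is an infinite set; (2) $\lim_{\varepsilon\to0}\sum_{|\lambda_n|>\varepsilon}\lambda_n=1$; (3) $\sum_{n}|\lambda_n|^{1+\varepsilon}<\infty$ for all $\varepsilon>0$.
   Context: $\sigma_p$ denotes the point spectrum; the nonzero eigenvalues $\lambda_n$ are listed repeated according to their algebraic multiplicities. *)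

theory Defs
  imports "HOL-Analysis.Analysis"
begin

text \<open>Complex L2[0,1], represented by functions real => complex (equality a.e. on [0,1]).\<close>

definition L2_01 :: "(real \<Rightarrow> complex) set" where
  "L2_01 = {f. f \<in> borel_measurable lborel \<and>
                set_integrable lborel {0..1} (\<lambda>x. (cmod (f x))\<^sup>2)}"

definition ae_eq01 :: "(real \<Rightarrow> complex) \<Rightarrow> (real \<Rightarrow> complex) \<Rightarrow> bool" where
  "ae_eq01 f g \<longleftrightarrow> (AE x in lborel. x \<in> {0..1} \<longrightarrow> f x = g x)"

definition Vphi :: "(real \<Rightarrow> real) \<Rightarrow> (real \<Rightarrow> complex) \<Rightarrow> (real \<Rightarrow> complex)" where
  "Vphi \<phi> f = (\<lambda>x. LINT t:{0..\<phi> x}|lborel. f t)"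

definition nonzero_eigs :: "(real \<Rightarrow> real) \<Rightarrow> complex set" where
  "nonzero_eigs \<phi> = {\<mu>. \<mu> \<noteq> 0 \<and> (\<exists>f\<in>L2_01. \<not> ae_eq01 f (\<lambda>_. 0) \<and>
                         ae_eq01 (Vphi \<phi> f) (\<lambda>x. \<mu> * f x))}"

definition gen_eigenspace :: "(real \<Rightarrow> real) \<Rightarrow> complex \<Rightarrow> (real \<Rightarrow> complex) set" where
  "gen_eigenspace \<phi> \<mu> = {f \<in> L2_01. \<exists>k::nat.
      ae_eq01 (((\<lambda>g. (\<lambda>x. Vphi \<phi> g x - \<mu> * g x)) ^^ k) f) (\<lambda>_. 0)}"

text \<open>Algebraic multiplicity: dimension of the generalized eigenspace in L2 (modulo null functions).\<close>
definition alg_mult :: "(real \<Rightarrow> real) \<Rightarrow> complex \<Rightarrow> enat" where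
  "alg_mult \<phi> \<mu> = Sup {enat n | n. \<exists>fs :: nat \<Rightarrow> real \<Rightarrow> complex.
      (\<forall>i<n. fs i \<in> gen_eigenspace \<phi> \<mu>) \<and>
      (\<forall>c :: nat \<Rightarrow> complex. ae_eq01 (\<lambda>x. \<Sum>i<n. c i * fs i x) (\<lambda>_. 0) \<longrightarrow> (\<forall>i<n. c i = 0))}"

definition eig_enum :: "(real \<Rightarrow> real) \<Rightarrow> (nat \<Rightarrow> complex) \<Rightarrow> bool" where
  "eig_enum \<phi> lam \<longleftrightarrow> range lam = nonzero_eigs \<phi> \<and>
     (\<forall>\<mu>\<in>nonzero_eigs \<phi>. finite {n. lam n = \<mu>} \<and> enat (card {n. lam n = \<mu>}) = alg_mult \<phi> \<mu>)"

end

theory Submission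
  imports Defs "HOL-Complex_Analysis.Complex_Analysis"
begin

text \<open>
  Write \<open>V f = (\<integral> f) \<cdot> 1 - W f\<close> with \<open>(W f) x\<close> the integral of \<open>f\<close> over \<open>{\<phi> x..1}\<close>. As \<open>\<phi> x \<ge> x\<close>, \<open>W\<close> is a
  Volterra operator, hence quasinilpotent, so \<open>V\<close> is a rank-one perturbation of \<open>- W\<close>. Its perturbation
  determinant (\<open>fdet\<close>, with coefficients \<open>fcoeff\<close>) is the entire function
  \<open>D z = 1 - z \<integral> (1 + z W)\<inverse> 1 = \<Sum> d\<^sub>n (- z)\<^sup>n\<close>, where \<open>d\<^sub>0 = 1\<close> and
  \<open>d\<^sub>n\<^sub>+\<^sub>1 = \<integral> W\<^sup>n 1\<close> is the volume of the set of \<open>x\<^sub>1, \<dots>, x\<^sub>n\<^sub>+\<^sub>1\<close> with \<open>\<phi> x\<^sub>i < x\<^sub>i\<^sub>+\<^sub>1\<close>. The eigenvalues are the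
  reciprocals of the zeros of \<open>D\<close>, with the same multiplicities: the Taylor coefficients of
  \<open>z \<mapsto> (1 + z W)\<inverse> 1\<close> at a zero yield a Jordan chain.

  Because \<open>\<phi> x > x\<close> inside the interval, chains \<open>\<phi> x\<^sub>i < x\<^sub>i\<^sub>+\<^sub>1\<close> accumulate only at the endpoints, which makes
  \<open>D\<close> of minimal exponential type. Dividing out the zeros in \<open>ball 0 \<rho>\<close>, bounding the cofactor on the
  circle of radius \<open>3 \<rho>\<close> and applying the Borel-Caratheodory inequality to its logarithm shows that the number of
  zeros is \<open>O(\<rho>)\<close> and that the sum of their reciprocals tends to \<open>- D' 0 = d\<^sub>1 = 1\<close>. The last
  hypothesis on \<open>\<phi>\<close> gives \<open>d\<^sub>n > 0\<close> for all \<open>n\<close>, so \<open>D\<close> is not a polynomial and has infinitely many zeros.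
\<close>

section \<open>Zeros of entire functions of minimal exponential type\<close>

text \<open>Schwarz lemma for \<open>g - g w\<close> followed by the Moebius map of the half plane \<open>Re \<zeta> < c / 2\<close> onto the disc.\<close>
lemma norm_deriv_le_Re_bound:
  assumes g: "g holomorphic_on ball w r" and r: "0 < r"
    and A: "\<And>z. z \<in> ball w r \<Longrightarrow> Re (g z) \<le> A"
  shows "cmod (deriv g w) \<le> 2 * (A - Re (g w)) / r"
proof (rule field_le_epsilon)
  fix e :: real assume e: "0 < e"
  \<comment> \<open>Raising the bound by \<open>e * r / 2\<close> makes \<open>c\<close> positive
    even when \<open>Re (g w) = A\<close>. In the final estimate this costs exactly
    \<open>e\<close>.\<close>
  define B where "B = A + e * r / 2"
  define c where "c = 2 * (B - Re (g w))"
  have AB: "A < B" unfolding B_def using e r by simp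
  have w: "w \<in> ball w r" using r by simp
  have c: "c > 0" unfolding c_def using A[OF w] AB by simp
  define k where "k = (\<lambda>u. g (w + of_real r * u) - g w)"
  define q where "q = (\<lambda>u. k u / (of_real c - k u))"
  have mem: "w + of_real r * u \<in> ball w r" if "cmod u < 1" for u
    using that r by (simp add: dist_norm norm_mult)
  have hk: "k holomorphic_on ball 0 1"
    unfolding k_def
    by (intro holomorphic_intros holomorphic_on_compose_gen[OF _ g, unfolded o_def]) (auto intro: mem)
  have Rek: "Re (k u) < c / 2" if "cmod u < 1" for u
    using A[OF mem[OF that]] AB unfolding k_def c_def by simp
  have den: "of_real c - k u \<noteq> 0" if "cmod u < 1" for u
  proof
    assume "of_real c - k u = 0"
    then have "Re (k u) = c" by (simp add: complex_eq_iff)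
    with Rek[OF that] c show False by simp
  qed
  have hq: "q holomorphic_on ball 0 1"
    unfolding q_def by (intro holomorphic_intros hk) (use den in auto)
  have q1: "cmod (q u) < 1" if "cmod u < 1" for u
  proof -
    have "(cmod (k u))\<^sup>2 < (cmod (of_real c - k u))\<^sup>2"
    proof -
      have "(cmod (of_real c - k u))\<^sup>2 - (cmod (k u))\<^sup>2 = c * (c - 2 * Re (k u))"
        unfolding cmod_power2 by (simp add: power2_eq_square algebra_simps)
      moreover have "\<dots> > 0" using c Rek[OF that] by simp
      ultimately show ?thesis by linarith
    qed
    then have "cmod (k u) < cmod (of_real c - k u)"
      by (simp add: power2_less_imp_less)
    then show ?thesis unfolding q_def using den[OF that] by (simp add: norm_divide)
  qed
  have "q 0 = 0" by (simp add: q_def k_def)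
  then have d1: "cmod (deriv q 0) \<le> 1"
    using Schwarz_Lemma(2)[OF hq _ q1, of 0] by simp
  have dg: "(g has_field_derivative deriv g w) (at (w + of_real r * 0))"
    using holomorphic_derivI[OF g open_ball w] by simp
  have dk: "(k has_field_derivative (deriv g w * of_real r)) (at 0)"
    unfolding k_def
  proof -
    have "((\<lambda>u. w + of_real r * u) has_field_derivative of_real r) (at 0)"
      by (rule derivative_eq_intros refl | simp)+
    from DERIV_chain2[where f = g and g = "\<lambda>u. w + of_real r * u", OF dg this]
    show "((\<lambda>u. g (w + of_real r * u) - g w) has_field_derivative (deriv g w * of_real r)) (at 0)"
      by (auto intro!: derivative_eq_intros)
  qed
  have k0: "k 0 = 0" by (simp add: k_def)
  have "(q has_field_derivative (deriv g w * of_real r / of_real c)) (at 0)"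
    unfolding q_def by (rule derivative_eq_intros dk refl | use c k0 in \<open>simp add: k0\<close>)+
  then have "deriv q 0 = deriv g w * of_real r / of_real c" by (rule DERIV_imp_deriv)
  with d1 c r have "cmod (deriv g w) * r / c \<le> 1" by (simp add: norm_mult norm_divide)
  then have "cmod (deriv g w) \<le> c / r" using c r by (simp add: field_simps)
  also have "c / r = 2 * (A - Re (g w)) / r + e"
    unfolding c_def B_def using r by (simp add: field_simps)
  finally show "cmod (deriv g w) \<le> 2 * (A - Re (g w)) / r + e" .
qed

section \<open>Orders of zeros and division by finitely many of them\<close>

definition zero_order :: "(complex \<Rightarrow> complex) \<Rightarrow> complex \<Rightarrow> nat" where
  "zero_order f a = (LEAST n. (deriv ^^ n) f a \<noteq> 0)"

text \<open>Otherwise the identity theorem makes \<open>f\<close> constantly 0, against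
  \<open>f 0 = 1\<close>. Hence the LEAST in \<open>zero_order\<close> is always attained.\<close>

lemma ex_nonzero_deriv:
  assumes f: "f holomorphic_on UNIV" and f0: "f 0 = 1"
  shows "\<exists>n. (deriv ^^ n) f a \<noteq> 0"
proof (rule ccontr)
  assume n: "\<not> ?thesis"
  then have "f 0 = f a"
    by (intro holomorphic_fun_eq_const_on_connected[OF f]) auto
  moreover have "f a = 0" using n by (metis funpow_0)
  ultimately show False using f0 by simp
qed

lemma zero_order_props:
  assumes f: "f holomorphic_on UNIV" and f0: "f 0 = 1"
  shows "(deriv ^^ zero_order f a) f a \<noteq> 0" and "\<And>j. j < zero_order f a \<Longrightarrow> (deriv ^^ j) f a = 0"
    and "f a = 0 \<Longrightarrow> zero_order f a > 0"
proof -
  show 1: "(deriv ^^ zero_order f a) f a \<noteq> 0"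
    unfolding zero_order_def by (rule LeastI_ex[OF ex_nonzero_deriv[OF f f0]])
  show "\<And>j. j < zero_order f a \<Longrightarrow> (deriv ^^ j) f a = 0"
    unfolding zero_order_def using not_less_Least by blast
  show "zero_order f a > 0" if "f a = 0"
    using 1 that by (cases "zero_order f a") auto
qed

text \<open>The usual factor \<open>w - a\<close> is rewritten as \<open>- a\<close> times
  \<open>1 - w / a\<close>, and the power of \<open>- a\<close> goes into \<open>g\<close>. With
  this normalisation every factor equals 1 at 0, where \<open>f\<close> is evaluated and
  differentiated later.\<close>

lemma local_factor:
  assumes f: "f holomorphic_on UNIV" and f0: "f 0 = 1" and fa: "f a = 0"
  obtains g r where "0 < r" "g holomorphic_on ball a r"
    "\<And>w. w \<in> ball a r \<Longrightarrow> f w = (1 - w / a) ^ zero_order f a * g w"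
    "\<And>w. w \<in> ball a r \<Longrightarrow> g w \<noteq> 0"
proof -
  have a0: "a \<noteq> 0" using f0 fa by auto
  define n where "n = zero_order f a"
  obtain g r where g: "0 < r" "g holomorphic_on ball a r"
    "\<And>w. w \<in> ball a r \<Longrightarrow> f w - f a = (w - a) ^ n * g w"
    "\<And>w. w \<in> ball a r \<Longrightarrow> g w \<noteq> 0"
  proof (rule holomorphic_factor_order_of_zero[OF f open_UNIV UNIV_I, where n = n and \<xi> = a])
    show "0 < n" "(deriv ^^ n) f a \<noteq> 0" "\<And>i. 0 < i \<Longrightarrow> i < n \<Longrightarrow> (deriv ^^ i) f a = 0"
      using zero_order_props[OF f f0, where a = a] fa unfolding n_def by auto
  qed blast
  show ?thesis
  proof (rule that[of r "\<lambda>w. (- a) ^ n * g w"])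
    fix w assume w: "w \<in> ball a r"
    have "(w - a) = (1 - w / a) * (- a)" using a0 by (simp add: field_simps)
    then have "(w - a) ^ n = (1 - w / a) ^ n * (- a) ^ n"
      by (metis power_mult_distrib)
    then show "f w = (1 - w / a) ^ zero_order f a * ((- a) ^ n * g w)"
      using g(3)[OF w] fa unfolding n_def by simp
    show "(- a) ^ n * g w \<noteq> 0" using g(4)[OF w] a0 by simp
  qed (use g in \<open>auto intro!: holomorphic_intros\<close>)
qed

text \<open>The quotient by the product is holomorphic off \<open>A\<close>. Near each
  \<open>a\<close> it agrees with the local cofactor over the remaining factors, so it extends
  continuously and the singularities are removable.\<close>

lemma divide_out_zeros:
  assumes f: "f holomorphic_on UNIV" and f0: "f 0 = 1"
    and A: "finite A" "\<And>a. a \<in> A \<Longrightarrow> f a = 0"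
  obtains h where "h holomorphic_on UNIV"
    "\<And>z. f z = (\<Prod>a\<in>A. (1 - z / a) ^ zero_order f a) * h z"
    "\<And>a. a \<in> A \<Longrightarrow> h a \<noteq> 0"
proof -
  define Q where "Q = (\<lambda>B z. (\<Prod>a\<in>B. (1 - z / a) ^ zero_order f a))"
  have A0: "a \<noteq> 0" if "a \<in> A" for a using A(2)[OF that] f0 by auto
  have "\<exists>g r. 0 < r \<and> g holomorphic_on ball a r \<and>
      (\<forall>w\<in>ball a r. f w = (1 - w / a) ^ zero_order f a * g w \<and> g w \<noteq> 0)" if "a \<in> A" for a
    using local_factor[OF f f0 A(2)[OF that]] by metis
  then obtain G R where GR: "\<And>a. a \<in> A \<Longrightarrow> 0 < R a" "\<And>a. a \<in> A \<Longrightarrow> G a holomorphic_on ball a (R a)"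
     "\<And>a w. a \<in> A \<Longrightarrow> w \<in> ball a (R a) \<Longrightarrow> f w = (1 - w / a) ^ zero_order f a * G a w"
     "\<And>a w. a \<in> A \<Longrightarrow> w \<in> ball a (R a) \<Longrightarrow> G a w \<noteq> 0"
    by metis
  \<comment> \<open>At a zero both \<open>f\<close> and the full product vanish, so the value there
    is taken from the local factorisation.\<close>
  define h where "h = (\<lambda>z. if z \<in> A then G z z / Q (A - {z}) z else f z / Q A z)"
  have Q0: "Q B z \<noteq> 0" if "B \<subseteq> A" "z \<notin> B" for B z
    unfolding Q_def using that A0 finite_subset[OF that(1) A(1)]
    by (auto simp: prod_zero_iff field_simps)
  have Qh: "Q B holomorphic_on S" for B S
    unfolding Q_def by (intro holomorphic_intros) (auto simp: divide_inverse intro!: holomorphic_intros)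
  have Qs: "Q A z = (1 - z / a) ^ zero_order f a * Q (A - {a}) z" if "a \<in> A" for a z
    unfolding Q_def using that A(1) by (simp add: prod.remove)
  have op: "open (- A)" using A(1) by (simp add: finite_imp_closed open_Compl)
  have h1: "h holomorphic_on - A"
  proof -
    have "(\<lambda>z. f z / Q A z) holomorphic_on - A"
      by (intro holomorphic_intros Qh holomorphic_on_subset[OF f]) (use Q0 in auto)
    then show ?thesis by (rule holomorphic_transform) (auto simp: h_def)
  qed
  have c2: "isCont h a" if a: "a \<in> A" for a
  proof -
    define U where "U = ball a (R a) \<inter> - (A - {a})"
    have U: "open U" "a \<in> U" unfolding U_def
      using GR(1)[OF a] A(1) by (force intro: open_Int[OF open_ball] open_Compl finite_imp_closed simp del: Compl_Diff_eq)+
    have "(\<lambda>z. G a z / Q (A - {a}) z) holomorphic_on U"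
      by (intro holomorphic_intros Qh holomorphic_on_subset[OF GR(2)[OF a]]) (use Q0 in \<open>auto simp: U_def\<close>)
    then have hol: "h holomorphic_on U"
    proof (rule holomorphic_transform)
      fix x assume x: "x \<in> U"
      show "G a x / Q (A - {a}) x = h x"
      proof (cases "x = a")
        case True then show ?thesis using a by (simp add: h_def)
      next
        case False
        then have xA: "x \<notin> A" using x by (auto simp: U_def)
        have "1 - x / a \<noteq> 0" using False A0[OF a] by (simp add: field_simps)
        then show ?thesis using xA Qs[OF a, of x] GR(3)[OF a, of x] x by (auto simp: h_def U_def)
      qed
    qed
    show ?thesis
      using holomorphic_on_imp_continuous_on[OF hol] U by (simp add: continuous_on_eq_continuous_at)
  qed
  have "isCont h z" for z
    using c2[of z] holomorphic_on_imp_continuous_on[OF h1] op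
    by (cases "z \<in> A") (auto simp: continuous_on_eq_continuous_at)
  then have "continuous_on UNIV h" by (simp add: continuous_on_eq_continuous_at)
  then have hh: "h holomorphic_on UNIV"
    by (rule no_isolated_singularity[OF _ _ open_UNIV A(1)]) (use h1 in \<open>simp add: Compl_eq_Diff_UNIV\<close>)
  show ?thesis
  proof (rule that[OF hh])
    fix z show "f z = (\<Prod>a\<in>A. (1 - z / a) ^ zero_order f a) * h z"
    proof (cases "z \<in> A")
      case True
      have "zero_order f z > 0" using zero_order_props(3)[OF f f0 A(2)[OF True]] .
      then have "Q A z = 0" using Qs[OF True, of z] A0[OF True] by simp
      then show ?thesis using A(2)[OF True] by (simp add: Q_def)
    next
      case False
      then show ?thesis using Q0[of A z] by (simp add: h_def Q_def)
    qed
  next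
    fix a assume a: "a \<in> A"
    show "h a \<noteq> 0" using a GR(4)[OF a, of a] GR(1)[OF a] Q0[of "A - {a}" a] by (auto simp: h_def)
  qed
qed


text \<open>The radius is chosen so that every factor has modulus at least
  \<open>cmod (z / a) - 1\<close>, which is at least 2.\<close>

lemma zero_product_norm_ge:
  assumes Z: "finite Z" "\<And>a. a \<in> Z \<Longrightarrow> a \<noteq> 0 \<and> cmod a \<le> \<rho>" and z: "3 * \<rho> \<le> cmod z"
  shows "2 ^ (\<Sum>a\<in>Z. m a) \<le> cmod (\<Prod>a\<in>Z. (1 - z / a) ^ m a)"
proof -
  have "2 ^ (\<Sum>a\<in>Z. m a) = (\<Prod>a\<in>Z. (2::real) ^ m a)" by (simp add: power_sum)
  also have "\<dots> \<le> (\<Prod>a\<in>Z. cmod (1 - z / a) ^ m a)"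
  proof (rule prod_mono)
    fix a assume "a \<in> Z"
    then have a: "a \<noteq> 0" "cmod a \<le> \<rho>" using Z by auto
    have "3 * cmod a \<le> cmod z" using a z by linarith
    then have "3 \<le> cmod (z / a)" using a by (simp add: norm_divide field_simps)
    moreover have "cmod (z / a) - 1 \<le> cmod (1 - z / a)"
      using norm_triangle_ineq2[of "z / a" 1] by (simp add: norm_minus_commute)
    ultimately show "0 \<le> (2::real) ^ m a \<and> 2 ^ m a \<le> cmod (1 - z / a) ^ m a"
      by (auto intro!: power_mono)
  qed
  finally show ?thesis by (simp add: prod_norm[symmetric] norm_power)
qed

text \<open>On the circle of radius \<open>3 * \<rho>\<close> the product is large, so
  \<open>h\<close> is small there; the maximum modulus principle carries the bound inside.\<close>

lemma cofactor_bound: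
  assumes f: "f holomorphic_on UNIV" and h: "h holomorphic_on UNIV"
    and fh: "\<And>z. f z = (\<Prod>a\<in>Z. (1 - z / a) ^ m a) * h z"
    and Z: "finite Z" "\<And>a. a \<in> Z \<Longrightarrow> a \<noteq> 0 \<and> cmod a \<le> \<rho>" and \<rho>: "0 < \<rho>"
    and M: "\<And>z. cmod z = 3 * \<rho> \<Longrightarrow> cmod (f z) \<le> M"
    and z: "cmod z \<le> 3 * \<rho>"
  shows "2 ^ (\<Sum>a\<in>Z. m a) * cmod (h z) \<le> M"
proof -
  have "cmod (h z) \<le> M / 2 ^ (\<Sum>a\<in>Z. m a)"
  proof (rule maximum_modulus_frontier[where S = "cball 0 (3 * \<rho>)" and f = h])
    fix w assume "w \<in> frontier (cball (0::complex) (3 * \<rho>))"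
    then have w: "cmod w = 3 * \<rho>" by simp
    have "2 ^ (\<Sum>a\<in>Z. m a) * cmod (h w) \<le> cmod (f w)"
      unfolding fh norm_mult using zero_product_norm_ge[OF Z, of w m] w
      by (intro mult_right_mono) auto
    with M[OF w] show "cmod (h w) \<le> M / 2 ^ (\<Sum>a\<in>Z. m a)"
      by (simp add: field_simps)
  qed (use z h holomorphic_on_imp_continuous_on in \<open>auto intro: holomorphic_on_subset continuous_on_subset\<close>)
  then show ?thesis by (simp add: field_simps)
qed

lemma finite_zeros_ball:
  assumes f: "f holomorphic_on UNIV" and f0: "f 0 = 1"
  shows "finite {a. f a = 0 \<and> cmod a < \<rho>}"
proof (cases "\<exists>a. f a = 0")
  case True
  have "finite {z \<in> cball 0 \<rho>. f z = 0}"
  proof (rule holomorphic_compact_finite_zeros[OF f])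
    show "\<not> f constant_on UNIV" using True f0 by (metis UNIV_I constant_on_def zero_neq_one)
  qed auto
  then show ?thesis by (rule rev_finite_subset) auto
qed simp

text \<open>The count is the cofactor bound at 0, where \<open>h\<close> is 1. For the sum, the
  cofactor has no zeros in the ball, so it is \<open>exp g\<close> with \<open>Re g\<close> at most
  \<open>ln M\<close> and \<open>Re (g 0) = 0\<close>. The derivative bound then applies to
  \<open>deriv g 0\<close>, the logarithmic derivative of the cofactor at 0.\<close>

lemma zeros_in_ball:
  assumes f: "f holomorphic_on UNIV" and f0: "f 0 = 1" and \<rho>: "0 < \<rho>"
    and M: "\<And>z. cmod z = 3 * \<rho> \<Longrightarrow> cmod (f z) \<le> M"
  defines "Z \<equiv> {a. f a = 0 \<and> cmod a < \<rho>}"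
  shows "2 ^ (\<Sum>a\<in>Z. zero_order f a) \<le> M"
    and "cmod (deriv f 0 + (\<Sum>a\<in>Z. of_nat (zero_order f a) / a)) \<le> 2 * ln M / \<rho>"
proof -
  have Z: "finite Z" unfolding Z_def using finite_zeros_ball[OF f f0] .
  have Z': "a \<noteq> 0 \<and> cmod a \<le> \<rho>" "f a = 0" if "a \<in> Z" for a using that f0 by (auto simp: Z_def)
  obtain h where h: "h holomorphic_on UNIV"
    "\<And>z. f z = (\<Prod>a\<in>Z. (1 - z / a) ^ zero_order f a) * h z"
    "\<And>a. a \<in> Z \<Longrightarrow> h a \<noteq> 0"
    using divide_out_zeros[OF f f0 Z Z'(2)] by metis
  have h0: "h 0 = 1" using h(2)[of 0] f0 by simp
  have b: "2 ^ (\<Sum>a\<in>Z. zero_order f a) * cmod (h z) \<le> M" if "cmod z \<le> 3 * \<rho>" for z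
    using cofactor_bound[OF f h(1,2) Z Z'(1) \<rho> M that] .
  show c: "2 ^ (\<Sum>a\<in>Z. zero_order f a) \<le> M" using b[of 0] h0 \<rho> by simp
  have M1: "1 \<le> M" using c by (meson order_trans one_le_power one_le_numeral)
  have hM: "cmod (h z) \<le> M" if "cmod z \<le> 3 * \<rho>" for z
  proof -
    have "1 * cmod (h z) \<le> 2 ^ (\<Sum>a\<in>Z. zero_order f a) * cmod (h z)"
      by (intro mult_right_mono) auto
    with b[OF that] show ?thesis by simp
  qed
  have nz: "h z \<noteq> 0" if "z \<in> ball 0 \<rho>" for z
    using h(3)[of z] h(2)[of z] that unfolding Z_def by auto
  obtain g where g: "g holomorphic_on ball 0 \<rho>" "\<And>z. z \<in> ball 0 \<rho> \<Longrightarrow> exp (g z) = h z"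
    using holomorphic_logarithm_exists[OF convex_ball open_ball holomorphic_on_subset[OF h(1) subset_UNIV] nz centre_in_ball[THEN iffD2, OF \<rho>]]
    by blast
  have Re: "Re (g z) = ln (cmod (h z))" if "z \<in> ball 0 \<rho>" for z
    unfolding g(2)[OF that, symmetric] norm_exp_eq_Re by simp
  have "cmod (deriv g 0) \<le> 2 * (ln M - Re (g 0)) / \<rho>"
  proof (rule norm_deriv_le_Re_bound[OF g(1) \<rho>])
    fix z assume z: "z \<in> ball (0::complex) \<rho>"
    show "Re (g z) \<le> ln M" unfolding Re[OF z]
      using hM[of z] z nz[OF z] \<rho> by (intro ln_mono) auto
  qed
  moreover have "Re (g 0) = 0" using Re[of 0] h0 \<rho> by simp
  moreover have "deriv g 0 = deriv f 0 + (\<Sum>a\<in>Z. of_nat (zero_order f a) / a)"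
  proof -
    define P where "P = (\<lambda>z. \<Prod>a\<in>Z. (1 - z / a) ^ zero_order f a)"
    have dg: "(g has_field_derivative deriv g 0) (at 0)"
      using holomorphic_derivI[OF g(1) open_ball] \<rho> by simp
    have P: "(P has_field_derivative (\<Prod>a\<in>Z. (1 - 0 / a) ^ zero_order f a) *
        (\<Sum>a\<in>Z. (of_nat (zero_order f a) * (- 1 / a)) / ((1 - 0 / a) ^ zero_order f a))) (at 0)"
      unfolding P_def
    proof (rule has_field_derivative_prod')
      fix a assume "a \<in> Z"
      then show "((\<lambda>z. (1 - z / a) ^ zero_order f a) has_field_derivative of_nat (zero_order f a) * (- 1 / a)) (at 0)"
        using Z'(1) by (auto intro!: derivative_eq_intros simp: divide_inverse)
    qed simp
    have "(P has_field_derivative - (\<Sum>a\<in>Z. of_nat (zero_order f a) / a)) (at 0)"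
      using P by (simp add: sum_negf)
    \<comment> \<open>Both \<open>P\<close> and \<open>exp g\<close> equal 1 at 0, so the derivative
      of their product is the sum of their logarithmic derivatives.\<close>
    from DERIV_mult[OF this DERIV_chain2[where f = exp, OF DERIV_exp dg]]
    have "((\<lambda>z. P z * exp (g z)) has_field_derivative
       (- (\<Sum>a\<in>Z. of_nat (zero_order f a) / a) + deriv g 0)) (at 0)"
      using g(2)[of 0] \<rho> h0 by (simp add: P_def)
    then have "(f has_field_derivative (- (\<Sum>a\<in>Z. of_nat (zero_order f a) / a) + deriv g 0)) (at 0)"
      by (rule has_field_derivative_transform_within_open[of _ _ _ "ball 0 \<rho>"])
         (use \<rho> g(2) h(2) in \<open>auto simp: P_def\<close>)
    then show ?thesis by (simp add: DERIV_imp_deriv)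
  qed
  ultimately show "cmod (deriv f 0 + (\<Sum>a\<in>Z. of_nat (zero_order f a) / a)) \<le> 2 * ln M / \<rho>"
    by simp
qed

text \<open>With finitely many zeros the cofactor is \<open>exp g\<close> for an entire
  \<open>g\<close>. Minimal exponential type forces \<open>deriv g\<close> to vanish, so the
  cofactor is 1 and \<open>f\<close> is a polynomial, against the nonvanishing Taylor coefficients
  at 0.\<close>

lemma infinite_zeros:
  assumes f: "f holomorphic_on UNIV" and f0: "f 0 = 1"
    and growth: "\<And>\<delta>. \<delta> > 0 \<Longrightarrow> \<exists>C. \<forall>z. cmod (f z) \<le> C * exp (\<delta> * cmod z)"
    and nonpoly: "\<And>n. (deriv ^^ n) f 0 \<noteq> 0"
  shows "infinite {a. f a = 0}"
proof
  assume fin: "finite {a. f a = 0}"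
  define Z where "Z = {a. f a = 0}"
  have Z: "finite Z" using fin by (simp add: Z_def)
  obtain h where h: "h holomorphic_on UNIV"
    "\<And>z. f z = (\<Prod>a\<in>Z. (1 - z / a) ^ zero_order f a) * h z"
    "\<And>a. a \<in> Z \<Longrightarrow> h a \<noteq> 0"
    using divide_out_zeros[OF f f0 Z] Z_def by blast
  have nz: "h z \<noteq> 0" for z
    using h(3)[of z] h(2)[of z] unfolding Z_def by auto
  obtain g where g: "g holomorphic_on UNIV" "\<And>z. exp (g z) = h z"
  proof (rule holomorphic_logarithm_exists[OF convex_UNIV open_UNIV h(1)])
    show "h z \<noteq> 0" for z by (rule nz)
  qed auto
  obtain B where B: "B > 0" "\<And>a. a \<in> Z \<Longrightarrow> cmod a \<le> B"
    using finite_imp_bounded[OF Z] bounded_pos by blast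
  have Z0: "a \<noteq> 0" if "a \<in> Z" for a using that f0 by (auto simp: Z_def)
  have dg0: "deriv g w = 0" for w
  proof -
    have small: "cmod (deriv g w) \<le> 3 * \<delta>" if \<delta>: "\<delta> > 0" for \<delta>
    proof -
      obtain C0 where C0: "\<And>z. cmod (f z) \<le> C0 * exp (\<delta> * cmod z)" using growth[OF \<delta>] by blast
      define C where "C = max C0 1"
      have C: "cmod (f z) \<le> C * exp (\<delta> * cmod z)" for z
        by (rule order_trans[OF C0]) (simp add: C_def mult_right_mono)
      have "C > 0" by (simp add: C_def)
      have "cmod (deriv g w) \<le> 3 * \<delta> + (ln C - Re (g w)) / \<rho>" if \<rho>: "\<rho> \<ge> max B (cmod w)" for \<rho>
      proof -
        have r: "\<rho> > 0" using \<rho> B by simp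
        have hb: "cmod (h z) \<le> C * exp (\<delta> * (3 * \<rho>))" if z: "cmod z \<le> 3 * \<rho>" for z
        proof -
          have "2 ^ (\<Sum>a\<in>Z. zero_order f a) * cmod (h z) \<le> C * exp (\<delta> * (3 * \<rho>))"
          proof (rule cofactor_bound[OF f h(1,2) Z _ r _ z])
            fix a assume "a \<in> Z"
            then show "a \<noteq> 0 \<and> cmod a \<le> \<rho>" using B(2)[of a] Z0[of a] \<rho> by simp
          next
            fix z assume "cmod z = 3 * \<rho>"
            then show "cmod (f z) \<le> C * exp (\<delta> * (3 * \<rho>))" using C[of z] by simp
          qed
          moreover have "1 * cmod (h z) \<le> 2 ^ (\<Sum>a\<in>Z. zero_order f a) * cmod (h z)"
            by (intro mult_right_mono) auto
          ultimately show ?thesis by simp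
        qed
        \<comment> \<open>As \<open>cmod w\<close> is at most \<open>\<rho>\<close>, the ball of
          radius \<open>2 * \<rho>\<close> about \<open>w\<close> stays in the disc of radius
          \<open>3 * \<rho>\<close> where \<open>hb\<close> holds. Letting \<open>\<rho>\<close>
          grow leaves only \<open>3 * \<delta>\<close>.\<close>
        have "cmod (deriv g w) \<le> 2 * ((ln C + \<delta> * (3 * \<rho>)) - Re (g w)) / (2 * \<rho>)"
        proof (rule norm_deriv_le_Re_bound)
          fix z assume "z \<in> ball w (2 * \<rho>)"
          then have "cmod (z - w) \<le> 2 * \<rho>" by (simp add: dist_norm norm_minus_commute)
          then have "cmod z \<le> 3 * \<rho>" using norm_triangle_ineq[of "z - w" w] \<rho> by simp
          from hb[OF this] have "exp (Re (g z)) \<le> C * exp (\<delta> * (3 * \<rho>))"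
            unfolding g(2)[of z, symmetric] norm_exp_eq_Re .
          also have "\<dots> = exp (ln C + \<delta> * (3 * \<rho>))" using \<open>C > 0\<close> by (simp add: exp_add)
          finally show "Re (g z) \<le> ln C + \<delta> * (3 * \<rho>)" by simp
        qed (use g(1) r in \<open>auto intro: holomorphic_on_subset\<close>)
        also have "\<dots> = 3 * \<delta> + (ln C - Re (g w)) / \<rho>" using r by (simp add: field_simps)
        finally show ?thesis .
      qed
      then have "eventually (\<lambda>\<rho>. cmod (deriv g w) \<le> 3 * \<delta> + (ln C - Re (g w)) / \<rho>) at_top"
        using eventually_ge_at_top[of "max B (cmod w)"] by (rule eventually_mono[rotated])
      moreover have "((\<lambda>\<rho>. 3 * \<delta> + (ln C - Re (g w)) / \<rho>) \<longlongrightarrow> 3 * \<delta> + 0) at_top"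
        by (rule tendsto_add[OF tendsto_const real_tendsto_divide_at_top[OF tendsto_const filterlim_ident]])
      ultimately show ?thesis
        using tendsto_lowerbound[of "\<lambda>\<rho>. 3 * \<delta> + (ln C - Re (g w)) / \<rho>" "3 * \<delta>" at_top] by simp
    qed
    have "cmod (deriv g w) \<le> 0 + e" if "e > 0" for e using small[of "e / 3"] that by simp
    then have "cmod (deriv g w) \<le> 0" by (rule field_le_epsilon)
    then show ?thesis by simp
  qed
  have "\<exists>c. \<forall>z\<in>UNIV. g z = c"
  proof (rule has_field_derivative_zero_constant[OF convex_UNIV])
    show "(g has_field_derivative 0) (at z within UNIV)" for z
      using holomorphic_derivI[OF g(1) open_UNIV UNIV_I, of z UNIV] dg0[of z] by simp
  qed
  then obtain c where c: "\<And>z. g z = c" by auto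
  have h1: "h z = 1" for z
  proof -
    have "h z = h 0" using g(2)[of z] g(2)[of 0] c[of z] c[of 0] by simp
    also have "h 0 = 1" using h(2)[of 0] f0 by simp
    finally show ?thesis .
  qed
  define k where "k = (\<Sum>a\<in>Z. zero_order f a)"
  define K where "K = (\<Prod>a\<in>Z. (1 + 1 / cmod a) ^ zero_order f a)"
  have fb: "cmod (f z) \<le> K * cmod z ^ k" if z: "cmod z \<ge> 1" for z
  proof -
    have "f z = (\<Prod>a\<in>Z. (1 - z / a) ^ zero_order f a)" using h(2)[of z] h1[of z] by simp
    then have "cmod (f z) = (\<Prod>a\<in>Z. cmod (1 - z / a) ^ zero_order f a)"
      by (simp only: prod_norm[symmetric] norm_power)
    also have "\<dots> \<le> (\<Prod>a\<in>Z. ((1 + 1 / cmod a) * cmod z) ^ zero_order f a)"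
    proof (intro prod_mono conjI power_mono)
      fix a assume "a \<in> Z"
      have "cmod (1 - z / a) \<le> 1 + cmod z / cmod a"
        using norm_triangle_ineq4[of 1 "z / a"] by (simp add: norm_divide)
      also have "\<dots> \<le> cmod z + cmod z / cmod a" using z by simp
      finally show "cmod (1 - z / a) \<le> (1 + 1 / cmod a) * cmod z" by (simp add: algebra_simps)
    qed auto
    also have "\<dots> = K * cmod z ^ k"
      unfolding K_def k_def by (simp add: power_mult_distrib prod.distrib power_sum)
    finally show ?thesis .
  qed
  \<comment> \<open>Growth of order \<open>k\<close> leaves a factor \<open>1 / r\<close> in
    Cauchy's inequality for the next derivative, which therefore vanishes.\<close>
  have "cmod ((deriv ^^ Suc k) f 0) \<le> fact (Suc k) * K / r" if r: "r \<ge> 1" for r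
  proof -
    have "cmod ((deriv ^^ Suc k) f 0) \<le> fact (Suc k) * (K * r ^ k) / r ^ Suc k"
      by (rule Cauchy_inequality)
         (use r fb f holomorphic_on_imp_continuous_on in
            \<open>auto intro: holomorphic_on_subset continuous_on_subset\<close>)
    also have "\<dots> = fact (Suc k) * K / r" using r by (simp add: field_simps)
    finally show ?thesis .
  qed
  then have ev: "eventually (\<lambda>r. cmod ((deriv ^^ Suc k) f 0) \<le> fact (Suc k) * K / r) at_top"
    using eventually_ge_at_top[of 1] by (rule eventually_mono[rotated])
  have "((\<lambda>r. fact (Suc k) * K / r) \<longlongrightarrow> 0) at_top"
    by (rule real_tendsto_divide_at_top[OF tendsto_const filterlim_ident])
  from tendsto_lowerbound[OF this ev]
  have "cmod ((deriv ^^ Suc k) f 0) \<le> 0" by simp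
  then show False using nonpoly[of "Suc k"] by simp
qed

section \<open>Counting bounds, summability and enumeration with multiplicity\<close>

lemma summable_powr_of_counting_bound:
  fixes x :: "nat \<Rightarrow> real"
  assumes pos: "\<And>n. 0 < x n" and \<epsilon>: "0 < \<epsilon>"
    and fin: "\<And>r. 0 < r \<Longrightarrow> finite {n. r < x n}"
    and count: "\<And>r. 0 < r \<Longrightarrow> r \<le> 1 \<Longrightarrow> real (card {n. r < x n}) \<le> K / r"
  shows "summable (\<lambda>n. x n powr (1 + \<epsilon>))"
proof -
  define p where "p = 1 + \<epsilon>"
  have p: "p > 0" using \<epsilon> by (simp add: p_def)
  \<comment> \<open>Dyadic decomposition: at most \<open>K / q k\<close> terms exceed
    \<open>q k\<close>, so level \<open>k\<close> contributes at most a multiple of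
    \<open>q k powr \<epsilon>\<close>, a geometric series.\<close>
  define q :: "nat \<Rightarrow> real" where "q = (\<lambda>k. (1/2) ^ k)"
  have q: "0 < q k" "q k \<le> 1" for k by (auto simp: q_def power_le_one)
  define A where "A = 1 + (\<Sum>n | 1 < x n. x n)"
  have xA: "x n \<le> A" for n
  proof (cases "1 < x n")
    case True
    have "x n \<le> (\<Sum>n | 1 < x n. x n)"
      using fin[of 1] True pos by (intro member_le_sum) (auto intro: less_imp_le)
    then show ?thesis by (simp add: A_def)
  next
    case False
    have "0 \<le> (\<Sum>n | 1 < x n. x n)" using pos by (intro sum_nonneg) (auto intro: less_imp_le)
    then show ?thesis using False by (simp add: A_def)
  qed
  \<comment> \<open>The first entry serves level 0, where \<open>x n\<close> is only known to be at
    most \<open>A\<close>; the second serves later levels, where \<open>x n\<close> is at most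
    \<open>2 * q k\<close> because the least \<open>k\<close> with \<open>q k < x n\<close> is
    taken.\<close>
  define c where "c = max (A powr p) (2 powr p)"
  have c0: "c \<ge> 0" by (simp add: c_def le_max_iff_disj)
  have K0: "0 \<le> K" using count[of 1] by (simp add: order_trans[OF of_nat_0_le_iff])
  have one: "\<exists>k. q k < x n \<and> x n powr p \<le> c * q k powr p" for n
  proof -
    define k where "k = (LEAST k. q k < x n)"
    have ex: "\<exists>k. q k < x n" unfolding q_def by (rule real_arch_pow_inv[OF pos]) simp
    have k: "q k < x n" unfolding k_def by (rule LeastI_ex[OF ex])
    have "x n powr p \<le> c * q k powr p"
    proof (cases k)
      case 0
      have "x n powr p \<le> A powr p" using xA[of n] pos[of n] p by (intro powr_mono2) auto
      then show ?thesis using 0 by (simp add: q_def c_def le_max_iff_disj)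
    next
      case (Suc j)
      then have "\<not> q j < x n" unfolding k_def using not_less_Least[of j "\<lambda>k. q k < x n"] by simp
      then have "x n \<le> 2 * q k" by (simp add: Suc q_def)
      then have "x n powr p \<le> (2 * q k) powr p" using pos[of n] p by (intro powr_mono2) auto
      also have "\<dots> = 2 powr p * q k powr p" using q[of k] by (simp add: powr_mult)
      also have "\<dots> \<le> c * q k powr p" by (intro mult_right_mono) (auto simp: c_def)
      finally show ?thesis .
    qed
    with k show ?thesis by blast
  qed
  then obtain kk where kk: "\<And>n. q (kk n) < x n" "\<And>n. x n powr p \<le> c * q (kk n) powr p" by metis
  define s where "s = (1/2) powr \<epsilon>"
  have s: "0 < s" "s < 1" unfolding s_def using \<epsilon> powr_less_mono2[of \<epsilon> "1/2" 1] by auto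
  have sum_s: "summable (\<lambda>k. s ^ k)" using s by (intro summable_geometric) simp
  have "(\<Sum>n<N. x n powr p) \<le> c * (K * (\<Sum>k. s ^ k))" for N
  proof -
    \<comment> \<open>Any bound above all levels \<open>kk n\<close> with \<open>n < N\<close> would
      do; it keeps the double sum finite so that it can be swapped.\<close>
    define L where "L = Suc (\<Sum>n<N. kk n)"
    have L: "kk n < L" if "n < N" for n
      using member_le_sum[of n "{..<N}" kk] that by (simp add: L_def)
    have "(\<Sum>n<N. x n powr p) \<le> (\<Sum>n<N. c * (\<Sum>k<L. if q k < x n then q k powr p else 0))"
    proof (rule sum_mono)
      fix n assume n: "n \<in> {..<N}"
      have "q (kk n) powr p = (if q (kk n) < x n then q (kk n) powr p else 0)" using kk(1) by simp
      also have "\<dots> \<le> (\<Sum>k<L. if q k < x n then q k powr p else 0)"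
        using L n by (intro member_le_sum[of "kk n" "{..<L}" "\<lambda>k. if q k < x n then q k powr p else 0"]) auto
      finally show "x n powr p \<le> c * (\<Sum>k<L. if q k < x n then q k powr p else 0)"
        using kk(2)[of n] c0 by (meson mult_left_mono order_trans)
    qed
    also have "\<dots> = c * (\<Sum>k<L. \<Sum>n<N. if q k < x n then q k powr p else 0)"
      by (subst sum.swap) (simp add: sum_distrib_left)
    also have "\<dots> \<le> c * (\<Sum>k<L. K * s ^ k)"
    proof (intro mult_left_mono[OF _ c0] sum_mono)
      fix k
      have "(\<Sum>n<N. if q k < x n then q k powr p else 0) = real (card ({..<N} \<inter> {n. q k < x n})) * q k powr p"
        by (simp add: sum.If_cases)
      also have "\<dots> \<le> (K / q k) * q k powr p"
      proof (intro mult_right_mono order_trans[OF _ count])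
        show "real (card ({..<N} \<inter> {n. q k < x n})) \<le> real (card {n. q k < x n})"
          using fin[OF q(1)] by (intro of_nat_mono card_mono) auto
      qed (use q in auto)
      also have "\<dots> = K * q k powr \<epsilon>" using q(1)[of k] by (simp add: p_def powr_add)
      also have "q k powr \<epsilon> = s ^ k"
        unfolding q_def s_def by (simp add: powr_powr mult.commute flip: powr_realpow)
      finally show "(\<Sum>n<N. if q k < x n then q k powr p else 0) \<le> K * s ^ k" .
    qed
    also have "\<dots> = c * (K * (\<Sum>k<L. s ^ k))" by (simp add: sum_distrib_left)
    also have "\<dots> \<le> c * (K * (\<Sum>k. s ^ k))"
      using s sum_s by (intro mult_left_mono c0 K0 sum_le_suminf) auto
    finally show ?thesis .
  qed
  then show ?thesis unfolding p_def[symmetric]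
    by (intro summableI_nonneg_bounded[where x = "c * (K * (\<Sum>k. s ^ k))"]) auto
qed

text \<open>Used twice: the identity for \<open>F\<close> gives the sum of the eigenvalues, the
  constant 1 gives their number.\<close>

lemma sum_fibres:
  fixes F :: "complex \<Rightarrow> complex"
  assumes "finite Z" "\<And>a. a \<in> Z \<Longrightarrow> a \<noteq> 0 \<and> finite {n. lam n = 1 / a} \<and> card {n. lam n = 1 / a} = m a"
  shows "finite (\<Union>a\<in>Z. {n. lam n = 1 / a})"
    "(\<Sum>n\<in>(\<Union>a\<in>Z. {n. lam n = 1 / a}). F (lam n)) = (\<Sum>a\<in>Z. of_nat (m a) * F (1 / a))"
proof -
  show "finite (\<Union>a\<in>Z. {n. lam n = 1 / a})" using assms by auto
  have "(\<Sum>n\<in>(\<Union>a\<in>Z. {n. lam n = 1 / a}). F (lam n)) = (\<Sum>a\<in>Z. \<Sum>n\<in>{n. lam n = 1 / a}. F (lam n))"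
    using assms by (intro sum.UNION_disjoint) auto
  also have "\<dots> = (\<Sum>a\<in>Z. of_nat (m a) * F (1 / a))"
    using assms by (intro sum.cong refl) simp
  finally show "(\<Sum>n\<in>(\<Union>a\<in>Z. {n. lam n = 1 / a}). F (lam n)) = (\<Sum>a\<in>Z. of_nat (m a) * F (1 / a))" .
qed

text \<open>The condition \<open>\<epsilon> < cmod (lam n)\<close> selects the zeros in the ball of
  radius \<open>1 / \<epsilon>\<close>, so \<open>zeros_in_ball\<close> applies with
  \<open>M = C * exp (3 * \<delta> / \<epsilon>)\<close>. The error is then
  \<open>6 * \<delta> + 2 * ln C * \<epsilon>\<close> with \<open>\<delta>\<close> arbitrary. For
  the count, the growth bound with \<open>\<delta> = 1\<close> suffices.\<close>

lemma reciprocal_zeros_enum: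
  assumes f: "f holomorphic_on UNIV" and f0: "f 0 = 1"
    and growth: "\<And>\<delta>. \<delta> > 0 \<Longrightarrow> \<exists>C. \<forall>z. cmod (f z) \<le> C * exp (\<delta> * cmod z)"
    and ran: "range lam = {\<mu>. \<mu> \<noteq> 0 \<and> f (1 / \<mu>) = 0}"
    and mult: "\<And>\<mu>. \<mu> \<in> range lam \<Longrightarrow> finite {n. lam n = \<mu>} \<and> card {n. lam n = \<mu>} = zero_order f (1 / \<mu>)"
  shows "\<And>\<epsilon>. \<epsilon> > 0 \<Longrightarrow> finite {n. \<epsilon> < cmod (lam n)}"
    and "((\<lambda>\<epsilon>. \<Sum>n\<in>{n. \<epsilon> < cmod (lam n)}. lam n) \<longlongrightarrow> - deriv f 0) (at_right 0)"
    and "\<And>\<epsilon>. \<epsilon> > 0 \<Longrightarrow> summable (\<lambda>n. cmod (lam n) powr (1 + \<epsilon>))"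
proof -
  define Z where "Z = (\<lambda>\<epsilon>. {a. f a = 0 \<and> cmod a < 1 / \<epsilon>})"
  have Z: "finite (Z \<epsilon>)" for \<epsilon> unfolding Z_def by (rule finite_zeros_ball[OF f f0])
  have lam0: "lam n \<noteq> 0" "f (1 / lam n) = 0" for n using ran by auto
  have set_eq: "{n. \<epsilon> < cmod (lam n)} = (\<Union>a\<in>Z \<epsilon>. {n. lam n = 1 / a})" if "\<epsilon> > 0" for \<epsilon>
  proof (rule set_eqI)
    fix n
    have "\<epsilon> < cmod (lam n) \<longleftrightarrow> cmod (1 / lam n) < 1 / \<epsilon>"
      using that lam0(1)[of n] by (simp add: norm_divide field_simps)
    moreover have "lam n = 1 / a \<longleftrightarrow> a = 1 / lam n" for a using lam0(1)[of n] by auto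
    ultimately show "n \<in> {n. \<epsilon> < cmod (lam n)} \<longleftrightarrow> n \<in> (\<Union>a\<in>Z \<epsilon>. {n. lam n = 1 / a})"
      using lam0(2)[of n] by (auto simp: Z_def)
  qed
  have fib: "a \<noteq> 0 \<and> finite {n. lam n = 1 / a} \<and> card {n. lam n = 1 / a} = zero_order f a" if "a \<in> Z \<epsilon>" for a \<epsilon>
  proof -
    have a0: "a \<noteq> 0" using that f0 by (auto simp: Z_def)
    then have "1 / a \<in> range lam" using that unfolding ran by (auto simp: Z_def)
    from mult[OF this] a0 show ?thesis by simp
  qed
  show fin: "finite {n. \<epsilon> < cmod (lam n)}" if "\<epsilon> > 0" for \<epsilon>
    unfolding set_eq[OF that] by (rule sum_fibres(1)[OF Z fib])
  have sum: "(\<Sum>n\<in>{n. \<epsilon> < cmod (lam n)}. F (lam n)) = (\<Sum>a\<in>Z \<epsilon>. of_nat (zero_order f a) * F (1 / a))"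
    if "\<epsilon> > 0" for \<epsilon> and F :: "complex \<Rightarrow> complex"
    unfolding set_eq[OF that] by (rule sum_fibres(2)[OF Z fib])
  have bound: "\<exists>C\<ge>1. \<forall>z. cmod (f z) \<le> C * exp (\<delta> * cmod z)" if \<delta>: "\<delta> > 0" for \<delta>
  proof -
    obtain C0 where C0: "\<And>z. cmod (f z) \<le> C0 * exp (\<delta> * cmod z)" using growth[OF \<delta>] by blast
    have "cmod (f z) \<le> max C0 1 * exp (\<delta> * cmod z)" for z
      by (rule order_trans[OF C0]) simp
    then show ?thesis by (meson max.cobounded2)
  qed
  have close: "\<exists>C\<ge>1. \<forall>\<epsilon>>0. cmod ((\<Sum>n\<in>{n. \<epsilon> < cmod (lam n)}. lam n) - (- deriv f 0)) \<le> 6 * \<delta> + 2 * ln C * \<epsilon>"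
    if \<delta>: "\<delta> > 0" for \<delta>
  proof -
    obtain C where C: "C \<ge> 1" "\<And>z. cmod (f z) \<le> C * exp (\<delta> * cmod z)" using bound[OF \<delta>] by blast
    have "cmod ((\<Sum>n\<in>{n. \<epsilon> < cmod (lam n)}. lam n) - (- deriv f 0)) \<le> 6 * \<delta> + 2 * ln C * \<epsilon>" if e: "\<epsilon> > 0" for \<epsilon>
    proof -
      have "cmod (deriv f 0 + (\<Sum>a\<in>Z \<epsilon>. of_nat (zero_order f a) / a)) \<le> 2 * ln (C * exp (\<delta> * (3 * (1 / \<epsilon>)))) / (1 / \<epsilon>)"
        unfolding Z_def
      proof (rule zeros_in_ball(2)[OF f f0])
        fix z assume "cmod z = 3 * (1 / \<epsilon>)"
        then show "cmod (f z) \<le> C * exp (\<delta> * (3 * (1 / \<epsilon>)))" using C(2)[of z] by simp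
      qed (use e in simp)
      also have "\<dots> = 6 * \<delta> + 2 * ln C * \<epsilon>" using C(1) e by (simp add: ln_mult field_simps)
      finally show ?thesis using sum[OF e, of "\<lambda>x. x"] by (simp add: add.commute)
    qed
    with C(1) show ?thesis by blast
  qed
  show "((\<lambda>\<epsilon>. \<Sum>n\<in>{n. \<epsilon> < cmod (lam n)}. lam n) \<longlongrightarrow> - deriv f 0) (at_right 0)"
  proof (rule tendstoI)
    fix e :: real assume e: "e > 0"
    \<comment> \<open>The constant part of the error is \<open>e / 2\<close>, and \<open>d\<close>
      below keeps the other part under \<open>e / 2\<close>. The \<open>+ 1\<close> in
      \<open>d\<close> covers \<open>ln C = 0\<close>.\<close>
    obtain C where C: "C \<ge> 1" "\<And>\<epsilon>. \<epsilon> > 0 \<Longrightarrow> cmod ((\<Sum>n\<in>{n. \<epsilon> < cmod (lam n)}. lam n) - (- deriv f 0)) \<le> 6 * (e / 12) + 2 * ln C * \<epsilon>"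
      using close[of "e / 12"] e by auto
    define d where "d = e / (4 * (ln C + 1))"
    have lC: "ln C \<ge> 0" using C(1) by simp
    have d: "d > 0" unfolding d_def using e lC by simp
    have "dist (\<Sum>n\<in>{n. \<epsilon> < cmod (lam n)}. lam n) (- deriv f 0) < e" if "0 < \<epsilon>" "\<epsilon> < d" for \<epsilon>
    proof -
      have "2 * ln C * \<epsilon> \<le> 2 * (ln C + 1) * \<epsilon>" using that by simp
      also have "\<dots> < 2 * (ln C + 1) * d" using that lC by simp
      also have "\<dots> = e / 2" unfolding d_def using lC by (simp add: field_simps)
      finally show ?thesis using C(2)[OF that(1)] unfolding dist_norm by linarith
    qed
    then show "\<forall>\<^sub>F \<epsilon> in at_right 0. dist (\<Sum>n\<in>{n. \<epsilon> < cmod (lam n)}. lam n) (- deriv f 0) < e"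
      unfolding eventually_at_right_field using d by blast
  qed
  fix \<epsilon> :: real assume \<epsilon>: "\<epsilon> > 0"
  obtain C where C: "C \<ge> 1" "\<And>z. cmod (f z) \<le> C * exp (1 * cmod z)" using bound[of 1] by auto
  show "summable (\<lambda>n. cmod (lam n) powr (1 + \<epsilon>))"
  proof (rule summable_powr_of_counting_bound[OF _ \<epsilon> fin, where K = "(ln C + 3) / ln 2"])
    fix r :: real assume r: "0 < r" "r \<le> 1"
    define k where "k = (\<Sum>a\<in>Z r. zero_order f a)"
    have "2 ^ k \<le> C * exp (1 * (3 * (1 / r)))"
      unfolding Z_def k_def
    proof (rule zeros_in_ball(1)[OF f f0])
      fix z assume "cmod z = 3 * (1 / r)"
      then show "cmod (f z) \<le> C * exp (1 * (3 * (1 / r)))" using C(2)[of z] by simp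
    qed (use r in simp)
    then have "ln ((2::real) ^ k) \<le> ln (C * exp (3 / r))" by (intro ln_mono) auto
    then have "real k * ln 2 \<le> ln C + 3 / r" using C(1) by (simp add: ln_mult ln_realpow)
    also have "\<dots> \<le> ln C / r + 3 / r" using r mult_right_mono[OF r(2) ln_ge_zero[OF C(1)]] by (simp add: field_simps)
    finally have "real k \<le> (ln C + 3) / ln 2 / r" using r by (simp add: field_simps)
    moreover have "card {n. r < cmod (lam n)} = k"
    proof -
      have "of_nat (card {n. r < cmod (lam n)}) = (of_nat k :: complex)"
        using sum[OF r(1), of "\<lambda>_. 1"] by (simp add: k_def)
      then show ?thesis by (simp only: of_nat_eq_iff)
    qed
    ultimately show "real (card {n. r < cmod (lam n)}) \<le> (ln C + 3) / ln 2 / r" by simp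
  qed (use lam0 in auto)
qed

text \<open>The disjoint union of \<open>m x\<close> copies of each \<open>x\<close> is countably
  infinite. The first component of a bijective enumeration of it hits \<open>x\<close> exactly
  \<open>m x\<close> times.\<close>

lemma ex_enum_with_multiplicity:
  fixes E :: "'a set" and m :: "'a \<Rightarrow> nat"
  assumes "countable E" "infinite E" "\<And>x. x \<in> E \<Longrightarrow> m x > 0"
  shows "\<exists>lam. range lam = E \<and> (\<forall>x\<in>E. finite {n::nat. lam n = x} \<and> card {n. lam n = x} = m x)"
proof -
  define S where "S = Sigma E (\<lambda>x. {..<m x})"
  have "countable S" unfolding S_def using assms(1) by (intro countable_SIGMA) auto
  moreover have fS: "fst ` S = E" unfolding S_def using assms(3) by force
  then have "infinite S" using assms(2) by (metis finite_imageI)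
  ultimately have b: "bij_betw (from_nat_into S) UNIV S" by (rule bij_betw_from_nat_into)
  define lam where "lam = (\<lambda>n. fst (from_nat_into S n))"
  have "range lam = fst ` (from_nat_into S ` UNIV)" unfolding lam_def by auto
  then have r: "range lam = E" using b fS by (simp add: bij_betw_def)
  have "finite {n. lam n = x} \<and> card {n. lam n = x} = m x" if x: "x \<in> E" for x
  proof -
    have "bij_betw (from_nat_into S) {n. lam n = x} ({x} \<times> {..<m x})"
      unfolding bij_betw_def
    proof
      show "inj_on (from_nat_into S) {n. lam n = x}"
        using b by (meson bij_betw_def inj_on_subset subset_UNIV)
      show "from_nat_into S ` {n. lam n = x} = {x} \<times> {..<m x}"
      proof
        show "from_nat_into S ` {n. lam n = x} \<subseteq> {x} \<times> {..<m x}"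
        proof
          fix y assume "y \<in> from_nat_into S ` {n. lam n = x}"
          then obtain n where n: "y = from_nat_into S n" "lam n = x" by auto
          then have "y \<in> S" "fst y = x" using b by (auto simp: bij_betw_def lam_def)
          then show "y \<in> {x} \<times> {..<m x}" by (auto simp: S_def)
        qed
        show "{x} \<times> {..<m x} \<subseteq> from_nat_into S ` {n. lam n = x}"
        proof
          fix y assume y: "y \<in> {x} \<times> {..<m x}"
          then have "y \<in> S" using x by (auto simp: S_def)
          then obtain n where "y = from_nat_into S n" using b by (auto simp: bij_betw_def)
          then show "y \<in> from_nat_into S ` {n. lam n = x}" using y by (auto simp: lam_def)
        qed
      qed
    qed
    then show ?thesis by (metis bij_betw_finite bij_betw_same_card card_cartesian_product_singleton card_lessThan finite_SigmaI finite.intros finite_lessThan)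
  qed
  with r show ?thesis by blast
qed

lemma countable_reciprocal_zeros:
  assumes f: "f holomorphic_on UNIV" and f0: "f 0 = 1"
  shows "countable {\<mu>. \<mu> \<noteq> 0 \<and> f (1 / \<mu>) = 0}"
proof -
  have "{a. f a = 0} \<subseteq> (\<Union>k::nat. {a. f a = 0 \<and> cmod a < real k})"
    using reals_Archimedean2 by fastforce
  moreover have "countable (\<Union>k::nat. {a. f a = 0 \<and> cmod a < real k})"
    using finite_zeros_ball[OF f f0] by (intro countable_UN) (auto intro: countable_finite)
  ultimately have "countable {a. f a = 0}" by (rule countable_subset)
  moreover have "{\<mu>. \<mu> \<noteq> 0 \<and> f (1 / \<mu>) = 0} \<subseteq> (\<lambda>a. 1 / a) ` {a. f a = 0}" by force
  ultimately show ?thesis by (meson countable_image countable_subset)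
qed

section \<open>The iterates of the Volterra part and their growth\<close>

text \<open>These are the functions \<open>W\<^sup>n 1\<close>. They are real and nonnegative on the
  interval, which permits monotonicity arguments.\<close>

primrec volterra_iter :: "(real \<Rightarrow> real) \<Rightarrow> nat \<Rightarrow> real \<Rightarrow> real" where
  "volterra_iter \<phi> 0 = (\<lambda>_. 1)"
| "volterra_iter \<phi> (Suc n) = (\<lambda>x. integral {\<phi> x..1} (volterra_iter \<phi> n))"

lemma has_integral_truncated_power:
  assumes "a \<le> 1"
  shows "((\<lambda>t. (1 - t) ^ n / fact n) has_integral ((1 - a) ^ Suc n / fact (Suc n))) {a..1::real}"
proof -
  have "((\<lambda>t. (1 - t) ^ n / fact n) has_integral
      (- ((1 - 1) ^ Suc n / fact (Suc n)) - - ((1 - a) ^ Suc n / fact (Suc n)))) {a..1}"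
  proof (rule fundamental_theorem_of_calculus[OF assms])
    fix t :: real
    have "real (Suc n) / fact (Suc n) = 1 / fact n" by (simp del: of_nat_Suc)
    moreover have "((\<lambda>t. - ((1 - t) ^ Suc n / fact (Suc n))) has_real_derivative
        (1 - t) ^ n * (real (Suc n) / fact (Suc n))) (at t within {a..1})"
      by (rule derivative_eq_intros refl | simp del: power_Suc fact_Suc of_nat_Suc add: mult.commute)+
    ultimately have "((\<lambda>t. - ((1 - t) ^ Suc n / fact (Suc n))) has_real_derivative (1 - t) ^ n / fact n) (at t within {a..1})"
      by simp
    then show "((\<lambda>t. - ((1 - t) ^ Suc n / fact (Suc n))) has_vector_derivative (1 - t) ^ n / fact n) (at t within {a..1})"
      by (simp add: has_real_derivative_iff_has_vector_derivative)
  qed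
  then show ?thesis by simp
qed

locale volterra =
  fixes \<phi> :: "real \<Rightarrow> real"
  assumes maps: "\<forall>x\<in>{0..1}. \<phi> x \<in> {0..1}"
    and mono: "mono_on {0..1} \<phi>"
    and cont: "continuous_on {0..1} \<phi>"
    and above: "\<forall>x\<in>{0<..<1}. \<phi> x > x"
begin

abbreviation w where "w \<equiv> volterra_iter \<phi>"

definition fcoeff :: "nat \<Rightarrow> real" where
  "fcoeff n = (case n of 0 \<Rightarrow> 1 | Suc m \<Rightarrow> integral {0..1} (w m))"

lemma fcoeff_simps [simp]: "fcoeff 0 = 1" "fcoeff (Suc n) = integral {0..1} (w n)"
  by (simp_all add: fcoeff_def)

lemma phi_bounds: "x \<in> {0..1} \<Longrightarrow> 0 \<le> \<phi> x" "x \<in> {0..1} \<Longrightarrow> \<phi> x \<le> 1"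
  using maps by auto

lemma phi_mono: "0 \<le> x \<Longrightarrow> x \<le> y \<Longrightarrow> y \<le> 1 \<Longrightarrow> \<phi> x \<le> \<phi> y"
  using mono by (auto simp: mono_on_def)

text \<open>The hypothesis \<open>above\<close> is silent at the endpoint. The midpoint of
  \<open>\<phi> 1\<close> and 1 would be mapped above \<open>\<phi> 1\<close>, against
  monotonicity.\<close>

lemma phi_1: "\<phi> 1 = 1"
proof (rule ccontr)
  assume "\<phi> 1 \<noteq> 1"
  then have l: "0 \<le> \<phi> 1" "\<phi> 1 < 1" using phi_bounds[of 1] by auto
  define x where "x = (1 + \<phi> 1) / 2"
  have x: "0 < x" "x < 1" "\<phi> 1 < x" using l by (auto simp: x_def)
  then have "x < \<phi> x" using above by auto
  also have "\<phi> x \<le> \<phi> 1" using x by (intro phi_mono) auto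
  finally show False using x by simp
qed

lemma phi_ge: "x \<in> {0..1} \<Longrightarrow> x \<le> \<phi> x"
  using above phi_1 phi_bounds[of x] by (cases "x = 0 \<or> x = 1") (auto intro: less_imp_le)

lemma w_cont: "continuous_on {0..1} (w n)"
proof (induction n)
  case (Suc n)
  have "continuous_on {0..1} (\<lambda>y. integral {y..1} (w n))"
    by (intro indefinite_integral_continuous_1' integrable_continuous_real Suc)
  then have "continuous_on {0..1} (\<lambda>x. integral {\<phi> x..1} (w n))"
    by (rule continuous_on_compose2[OF _ cont]) (use maps in auto)
  then show ?case by simp
qed simp

lemma w_cont_sub: "0 \<le> a \<Longrightarrow> b \<le> 1 \<Longrightarrow> continuous_on {a..b} (w n)"
  by (rule continuous_on_subset[OF w_cont]) auto

lemma w_int: "0 \<le> a \<Longrightarrow> b \<le> 1 \<Longrightarrow> w n integrable_on {a..b}"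
  by (intro integrable_continuous_real w_cont_sub)

text \<open>Since \<open>\<phi> x\<close> is at least \<open>x\<close>, the domain of integration
  lies in \<open>{x..1}\<close>, and the iterates are dominated by those of the classical Volterra
  operator.\<close>

lemma w_bounds:
  assumes "x \<in> {0..1}"
  shows "0 \<le> w n x \<and> w n x \<le> (1 - x) ^ n / fact n"
  using assms
proof (induction n arbitrary: x)
  case (Suc n)
  have p: "0 \<le> \<phi> x" "\<phi> x \<le> 1" "x \<le> \<phi> x" using phi_bounds phi_ge Suc.prems by auto
  have nn: "0 \<le> w (Suc n) x"
    using Suc.IH p by (auto intro!: Henstock_Kurzweil_Integration.integral_nonneg w_int)
  have I: "((\<lambda>t. (1 - t) ^ n / fact n) has_integral ((1 - \<phi> x) ^ Suc n / fact (Suc n))) {\<phi> x..1}"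
    by (rule has_integral_truncated_power[OF p(2)])
  have "w (Suc n) x \<le> (1 - \<phi> x) ^ Suc n / fact (Suc n)"
    unfolding volterra_iter.simps
    by (rule has_integral_le[OF integrable_integral[OF w_int] I]) (use Suc.IH p in auto)
  also have "\<dots> \<le> (1 - x) ^ Suc n / fact (Suc n)"
    using p by (intro divide_right_mono power_mono) auto
  finally show ?case using nn by simp
qed simp

lemma w_le_fact: "x \<in> {0..1} \<Longrightarrow> w n x \<le> 1 / fact n"
  using w_bounds[of x n] by (fastforce intro: order_trans divide_right_mono power_le_one)

lemma w_antimono:
  assumes "0 \<le> x" "x \<le> y" "y \<le> 1"
  shows "w n y \<le> w n x"
proof (cases n)
  case (Suc m)
  have p: "0 \<le> \<phi> x" "\<phi> x \<le> \<phi> y" "\<phi> y \<le> 1" using assms phi_bounds phi_mono by auto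
  then have "integral {\<phi> y..1} (w m) \<le> integral {\<phi> x..1} (w m)"
    using w_bounds by (intro integral_subset_le w_int) auto
  then show ?thesis by (simp add: Suc)
qed simp

lemma w_integral_bounds:
  assumes "0 \<le> a" "a \<le> b" "b \<le> 1"
  shows "0 \<le> integral {a..b} (w n)" "integral {a..b} (w n) \<le> 1 / fact n"
proof -
  show "0 \<le> integral {a..b} (w n)"
    using w_bounds assms by (intro Henstock_Kurzweil_Integration.integral_nonneg w_int) auto
  have "integral {a..b} (w n) \<le> integral {a..b} (\<lambda>_. 1 / fact n)"
    using w_le_fact assms by (intro integral_le w_int) auto
  also have "\<dots> = (b - a) * (1 / fact n)" using assms by simp
  also have "\<dots> \<le> 1 * (1 / fact n)" using assms by (intro mult_right_mono) auto
  finally show "integral {a..b} (w n) \<le> 1 / fact n" by simp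
qed

lemma fcoeff_bounds: "0 \<le> fcoeff n" "fcoeff n \<le> 1"
proof -
  show "0 \<le> fcoeff n" using w_integral_bounds(1)[of 0 1] by (cases n) auto
  show "fcoeff n \<le> 1"
  proof (cases n)
    case (Suc m)
    have "integral {0..1} (w m) \<le> 1 / fact m" using w_integral_bounds(2)[of 0 1 m] by simp
    also have "\<dots> \<le> 1" by simp
    finally show ?thesis by (simp add: Suc)
  qed simp
qed

section \<open>Series in the iterates and the action of the operator on them\<close>

definition admissible :: "(nat \<Rightarrow> complex) \<Rightarrow> bool" where
  "admissible c \<longleftrightarrow> summable (\<lambda>n. cmod (c n) / fact n)"

text \<open>The weights in \<open>admissible\<close> match the bound \<open>1 / fact n\<close> on
  the iterates, so the series converges uniformly. The value 0 outside the interval makes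
  measurability on the whole line follow from continuity on \<open>{0..1}\<close>.\<close>

definition wser :: "(nat \<Rightarrow> complex) \<Rightarrow> real \<Rightarrow> complex" where
  "wser c x = (if x \<in> {0..1} then \<Sum>n. c n * of_real (w n x) else 0)"

lemma admissible_mult_bounded:
  assumes "admissible c" "\<And>n. 0 \<le> e n" "\<And>n. e n \<le> 1 / fact n"
  shows "summable (\<lambda>n. c n * of_real (e n))"
proof (rule summable_comparison_test[OF _ assms(1)[unfolded admissible_def]])
  have "cmod (c n * of_real (e n)) \<le> cmod (c n) / fact n" for n
    using assms(2,3)[of n] mult_left_mono[of "e n" "1 / fact n" "cmod (c n)"] by (simp add: norm_mult)
  then show "\<exists>N. \<forall>n\<ge>N. cmod (c n * of_real (e n)) \<le> cmod (c n) / fact n" by blast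
qed

lemma wser_sums: "admissible c \<Longrightarrow> x \<in> {0..1} \<Longrightarrow> (\<lambda>n. c n * of_real (w n x)) sums wser c x"
  unfolding wser_def using w_bounds w_le_fact by (auto intro!: summable_sums admissible_mult_bounded)

lemma wser_uniform:
  assumes "admissible c"
  shows "uniform_limit {0..1} (\<lambda>N x. \<Sum>n<N. c n * of_real (w n x)) (wser c) sequentially"
proof -
  have "uniform_limit {0..1} (\<lambda>N x. \<Sum>n<N. c n * of_real (w n x)) (\<lambda>x. \<Sum>n. c n * of_real (w n x)) sequentially"
  proof (rule Weierstrass_m_test[OF _ assms[unfolded admissible_def]])
    fix n and x :: real assume x: "x \<in> {0..1}"
    show "cmod (c n * of_real (w n x)) \<le> cmod (c n) / fact n"
      using w_bounds[OF x, of n] mult_left_mono[OF w_le_fact[OF x, of n], of "cmod (c n)"]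
      by (simp add: norm_mult)
  qed
  then show ?thesis by (rule uniform_limit_cong'[THEN iffD1, rotated 2]) (auto simp: wser_def)
qed

lemma wser_cont: "admissible c \<Longrightarrow> continuous_on {0..1} (wser c)"
  by (rule uniform_limit_theorem[OF _ wser_uniform])
     (auto intro!: always_eventually continuous_intros w_cont)

lemma wser_set_integrable: "admissible c \<Longrightarrow> 0 \<le> a \<Longrightarrow> b \<le> 1 \<Longrightarrow> set_integrable lborel {a..b} (wser c)"
  by (intro borel_integrable_atLeastAtMost' continuous_on_subset[OF wser_cont]) auto

text \<open>Uniform convergence permits termwise integration, done for the Henstock-Kurzweil
  integral and then transferred to the Lebesgue integral.\<close>

lemma wser_integral_sums:
  assumes c: "admissible c" and ab: "0 \<le> a" "a \<le> b" "b \<le> 1"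
  shows "(\<lambda>n. c n * of_real (integral {a..b} (w n))) sums (LINT t:{a..b}|lborel. wser c t)"
proof -
  have u: "uniform_limit (cbox a b) (\<lambda>N x. \<Sum>n<N. c n * of_real (w n x)) (wser c) sequentially"
    using uniform_limit_on_subset[OF wser_uniform[OF c]] ab by auto
  have wi: "((\<lambda>x. c n * of_real (w n x)) has_integral (c n * of_real (integral {a..b} (w n)))) {a..b}" for n
    using w_int[of a b n] ab
    by (intro has_integral_mult_right has_integral_linear[OF integrable_integral bounded_linear_of_real, unfolded o_def]) auto
  have part: "((\<lambda>x. \<Sum>n<N. c n * of_real (w n x)) has_integral (\<Sum>n<N. c n * of_real (integral {a..b} (w n)))) (cbox a b)" for N
    using wi by (auto intro!: has_integral_sum)
  obtain I J where IJ: "\<And>N. ((\<lambda>x. \<Sum>n<N. c n * of_real (w n x)) has_integral I N) (cbox a b)"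
      "(wser c has_integral J) (cbox a b)" "(I \<longlongrightarrow> J) sequentially"
    by (rule uniform_limit_integral_cbox[OF u])
       (use ab in \<open>auto intro!: continuous_intros w_cont_sub\<close>)
  have "I = (\<lambda>N. \<Sum>n<N. c n * of_real (integral {a..b} (w n)))"
    using has_integral_unique[OF IJ(1) part] by auto
  moreover have "J = (LINT t:{a..b}|lborel. wser c t)"
    using set_borel_integral_eq_integral(2)[OF wser_set_integrable[OF c ab(1,3)]] IJ(2)
    by (simp add: integral_unique)
  ultimately show ?thesis using IJ(3) by (simp add: sums_def)
qed

text \<open>The action of \<open>V\<close> on the coefficients of a series \<open>\<Sum> c\<^sub>n W\<^sup>n 1\<close>.\<close>
definition Vcoeff :: "(nat \<Rightarrow> complex) \<Rightarrow> nat \<Rightarrow> complex" where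
  "Vcoeff c k = (case k of 0 \<Rightarrow> (\<Sum>n. c n * of_real (fcoeff (Suc n))) | Suc n \<Rightarrow> - c n)"

lemma Vcoeff_simps [simp]: "Vcoeff c 0 = (\<Sum>n. c n * of_real (integral {0..1} (w n)))" "Vcoeff c (Suc n) = - c n"
  by (simp_all add: Vcoeff_def)

lemma admissible_Vcoeff: assumes "admissible c" shows "admissible (Vcoeff c)"
proof -
  have "summable (\<lambda>n. cmod (c n) / fact (Suc n))"
  proof (rule summable_comparison_test[OF _ assms[unfolded admissible_def]])
    have "norm (cmod (c n) / fact (Suc n)) \<le> cmod (c n) / fact n" for n
      by (simp add: divide_left_mono)
    then show "\<exists>N. \<forall>n\<ge>N. norm (cmod (c n) / fact (Suc n)) \<le> cmod (c n) / fact n" by blast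
  qed
  then show ?thesis unfolding admissible_def
    by (subst summable_Suc_iff[symmetric]) simp
qed

lemma admissible_Vcoeff_pow: "admissible c \<Longrightarrow> admissible ((Vcoeff ^^ k) c)"
  by (induction k) (auto intro: admissible_Vcoeff)

lemma wser_0: "wser (\<lambda>_. 0) x = 0" by (simp add: wser_def)

lemma admissible_lin: "admissible c \<Longrightarrow> admissible e \<Longrightarrow> admissible (\<lambda>n. a * c n + b * e n)"
proof -
  assume ce: "admissible c" "admissible e"
  have s: "summable (\<lambda>n. cmod a * (cmod (c n) / fact n) + cmod b * (cmod (e n) / fact n))"
    using ce unfolding admissible_def by (intro summable_add summable_mult)
  have "norm (cmod (a * c n + b * e n) / fact n) \<le> cmod a * (cmod (c n) / fact n) + cmod b * (cmod (e n) / fact n)" for n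
    using norm_triangle_ineq[of "a * c n" "b * e n"]
    by (simp add: norm_mult divide_right_mono flip: add_divide_distrib)
  then show ?thesis unfolding admissible_def by (intro summable_comparison_test[OF _ s]) blast
qed

lemma wser_lin:
  assumes "admissible c" "admissible e" "x \<in> {0..1}"
  shows "wser (\<lambda>n. a * c n + b * e n) x = a * wser c x + b * wser e x"
proof -
  have "(\<lambda>n. a * (c n * of_real (w n x)) + b * (e n * of_real (w n x))) sums (a * wser c x + b * wser e x)"
    by (intro sums_add sums_mult wser_sums assms)
  then have "(\<lambda>n. (a * c n + b * e n) * of_real (w n x)) sums (a * wser c x + b * wser e x)"
    by (simp add: algebra_simps)
  then show ?thesis using wser_sums[OF admissible_lin[OF assms(1,2)] assms(3)] sums_unique2 by blast
qed

lemma Vcoeff_lin: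
  assumes "admissible c" "admissible e"
  shows "Vcoeff (\<lambda>n. a * c n + b * e n) = (\<lambda>n. a * Vcoeff c n + b * Vcoeff e n)"
proof
  fix k show "Vcoeff (\<lambda>n. a * c n + b * e n) k = a * Vcoeff c k + b * Vcoeff e k"
  proof (cases k)
    case 0
    have s: "summable (\<lambda>n. c n * of_real (integral {0..1} (w n)))" if "admissible c" for c
      using that w_integral_bounds[of 0 1] by (intro admissible_mult_bounded) auto
    have "(\<lambda>n. a * (c n * of_real (integral {0..1} (w n))) + b * (e n * of_real (integral {0..1} (w n))))
      sums (a * Vcoeff c 0 + b * Vcoeff e 0)"
      unfolding Vcoeff_simps by (intro sums_add sums_mult summable_sums s assms)
    then show ?thesis unfolding 0 by (simp add: sums_iff algebra_simps)
  qed simp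
qed

text \<open>Cutting \<open>{0..1}\<close> at \<open>\<phi> x\<close> writes each integral as a
  constant minus the next iterate: the constants sum to coefficient 0, the iterates shift the
  sequence by one with a sign. Computations with the operator thus become computations with
  coefficients.\<close>

lemma Vphi_wser:
  assumes c: "admissible c" and x: "x \<in> {0..1}"
  shows "Vphi \<phi> (wser c) x = wser (Vcoeff c) x"
proof -
  have p: "0 \<le> \<phi> x" "\<phi> x \<le> 1" using phi_bounds x by auto
  have split: "integral {0..\<phi> x} (w n) = integral {0..1} (w n) - w (Suc n) x" for n
    using Henstock_Kurzweil_Integration.integral_combine[OF p w_int[of 0 1 n]] by simp
  have 1: "(\<lambda>n. c n * of_real (integral {0..\<phi> x} (w n))) sums Vphi \<phi> (wser c) x"
    unfolding Vphi_def using wser_integral_sums[OF c, of 0 "\<phi> x"] p by simp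
  have "(\<lambda>n. c n * of_real (integral {0..1} (w n))) sums Vcoeff c 0"
    unfolding Vcoeff_simps using w_integral_bounds[of 0 1] by (intro summable_sums admissible_mult_bounded c) auto
  moreover have "(\<lambda>n. Vcoeff c (Suc n) * of_real (w (Suc n) x)) sums (wser (Vcoeff c) x - Vcoeff c 0 * of_real (w 0 x))"
    using wser_sums[OF admissible_Vcoeff[OF c] x] by (subst sums_Suc_iff) simp
  ultimately have "(\<lambda>n. c n * of_real (integral {0..1} (w n)) + Vcoeff c (Suc n) * of_real (w (Suc n) x)) sums
      (Vcoeff c 0 + (wser (Vcoeff c) x - Vcoeff c 0 * of_real (w 0 x)))" by (rule sums_add)
  then have "(\<lambda>n. c n * of_real (integral {0..\<phi> x} (w n))) sums wser (Vcoeff c) x"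
    unfolding split by (simp add: algebra_simps)
  with 1 show ?thesis using sums_unique2 by blast
qed

end

section \<open>Minimal exponential type and positivity of the coefficients\<close>

context volterra
begin

text \<open>A truncation of \<open>(1 - r W)\<inverse> 1\<close>. Finite sums avoid convergence
  questions; the bounds below are uniform in \<open>N\<close>.\<close>

definition psum :: "real \<Rightarrow> nat \<Rightarrow> real \<Rightarrow> real" where
  "psum r N x = (\<Sum>n<N. r ^ n * w n x)"

lemma psum_int: "0 \<le> a \<Longrightarrow> b \<le> 1 \<Longrightarrow> psum r N integrable_on {a..b}"
  unfolding psum_def by (intro integrable_continuous_real continuous_intros w_cont_sub)

lemma psum_nonneg: "0 \<le> r \<Longrightarrow> x \<in> {0..1} \<Longrightarrow> 0 \<le> psum r N x"
  unfolding psum_def using w_bounds by (auto intro!: sum_nonneg)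

lemma psum_antimono: "0 \<le> r \<Longrightarrow> 0 \<le> x \<Longrightarrow> x \<le> y \<Longrightarrow> y \<le> 1 \<Longrightarrow> psum r N y \<le> psum r N x"
  unfolding psum_def by (intro sum_mono mult_left_mono w_antimono) auto

lemma psum_mono_Suc: "0 \<le> r \<Longrightarrow> x \<in> {0..1} \<Longrightarrow> psum r N x \<le> psum r (Suc N) x"
  unfolding psum_def using w_bounds[of x N] by simp

lemma psum_integral: "0 \<le> a \<Longrightarrow> b \<le> 1 \<Longrightarrow> integral {a..b} (psum r N) = (\<Sum>n<N. r ^ n * integral {a..b} (w n))"
  unfolding psum_def by (subst Henstock_Kurzweil_Integration.integral_sum) (auto intro!: w_int integrable_on_mult_right)

lemma psum_Suc: "x \<in> {0..1} \<Longrightarrow> psum r (Suc N) x = 1 + r * integral {\<phi> x..1} (psum r N)"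
proof -
  assume x: "x \<in> {0..1}"
  have "psum r (Suc N) x = 1 + (\<Sum>n<N. r ^ Suc n * w (Suc n) x)"
    unfolding psum_def by (subst sum.lessThan_Suc_shift) simp
  also have "(\<Sum>n<N. r ^ Suc n * w (Suc n) x) = r * integral {\<phi> x..1} (psum r N)"
    using phi_bounds[OF x] by (simp add: psum_integral sum_distrib_left mult.assoc)
  finally show ?thesis .
qed

lemma psum_integral_tail:
  assumes "0 \<le> r" "0 \<le> a" "a \<le> 1"
  shows "integral {a..1} (psum r N) \<le> psum r N a"
proof -
  have "integral {a..1} (psum r N) \<le> integral {a..1} (\<lambda>_. psum r N a)"
    using assms by (intro integral_le psum_int) (auto intro: psum_antimono)
  also have "\<dots> \<le> 1 * psum r N a"
    using assms psum_nonneg[of r a N] mult_right_mono[of "1 - a" 1 "psum r N a"] by simp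
  finally show ?thesis by simp
qed

text \<open>A Gronwall estimate by induction on \<open>N\<close>: replacing \<open>\<phi> x\<close>
  by \<open>x\<close> only enlarges the integral, and \<open>B\<close> absorbs what lies to the
  right of \<open>b\<close>. It costs \<open>exp (r * length)\<close>, so it is spent only on the
  two short end intervals.\<close>

lemma psum_gronwall:
  assumes r: "0 \<le> r" and b: "0 \<le> b" "b \<le> 1" and B: "\<And>N. 1 + r * integral {b..1} (psum r N) \<le> B"
    and x: "0 \<le> x" "x \<le> b"
  shows "psum r N x \<le> B * exp (r * (b - x))"
  using x
proof (induction N arbitrary: x)
  case 0
  have "1 \<le> B" using B[of 0] by (simp add: psum_def[abs_def])
  then show ?case by (simp add: psum_def)
next
  case (Suc N)
  have B0: "0 \<le> B" using B[of 0] by (simp add: psum_def[abs_def])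
  have x: "0 \<le> x" "x \<le> b" "x \<le> 1" "x \<in> {0..1}" using Suc.prems b by auto
  have E: "((\<lambda>t. r * (B * exp (r * (b - t)))) has_integral (- (B * exp (r * (b - b))) - - (B * exp (r * (b - x))))) {x..b}"
  proof (rule fundamental_theorem_of_calculus[OF x(2)])
    fix t :: real
    show "((\<lambda>t. - (B * exp (r * (b - t)))) has_vector_derivative r * (B * exp (r * (b - t)))) (at t within {x..b})"
      unfolding has_real_derivative_iff_has_vector_derivative[symmetric]
      by (auto intro!: derivative_eq_intros)
  qed
  have "r * integral {x..b} (psum r N) = integral {x..b} (\<lambda>t. r * psum r N t)" by simp
  also have "\<dots> \<le> - (B * exp (r * (b - b))) - - (B * exp (r * (b - x)))"
  proof (rule has_integral_le[OF _ E])
    show "((\<lambda>t. r * psum r N t) has_integral integral {x..b} (\<lambda>t. r * psum r N t)) {x..b}"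
      using x b by (intro integrable_integral integrable_on_mult_right psum_int) auto
    show "r * psum r N t \<le> r * (B * exp (r * (b - t)))" if "t \<in> {x..b}" for t
      using that x r by (intro mult_left_mono Suc.IH) auto
  qed
  finally have 1: "r * integral {x..b} (psum r N) \<le> B * exp (r * (b - x)) - B" by simp
  have "integral {\<phi> x..1} (psum r N) \<le> integral {x..1} (psum r N)"
    using phi_ge[OF x(4)] phi_bounds[OF x(4)] x r
    by (intro integral_subset_le psum_int) (auto intro!: psum_nonneg)
  also have "\<dots> = integral {x..b} (psum r N) + integral {b..1} (psum r N)"
    using Henstock_Kurzweil_Integration.integral_combine[OF x(2) b(2) psum_int[of x 1 r N]] x by simp
  finally have "r * integral {\<phi> x..1} (psum r N) \<le> r * integral {x..b} (psum r N) + r * integral {b..1} (psum r N)"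
    using r by (simp add: mult_left_mono flip: distrib_left)
  then show ?case using 1 B[of N] psum_Suc[OF x(4), of r N] by linarith
qed

text \<open>The continuous function \<open>\<phi> x - x\<close> is positive on the compact middle
  interval and attains its minimum; if that interval is empty, any \<open>\<eta>\<close>
  serves.\<close>

lemma phi_gap:
  assumes "0 < \<delta>"
  obtains \<eta> where "0 < \<eta>" "\<And>x. \<delta> \<le> x \<Longrightarrow> x \<le> 1 - \<delta> \<Longrightarrow> x + \<eta> \<le> \<phi> x"
proof (cases "\<delta> \<le> 1 - \<delta>")
  case True
  have "continuous_on {\<delta>..1 - \<delta>} (\<lambda>x. \<phi> x - x)"
    using assms by (intro continuous_intros continuous_on_subset[OF cont]) auto
  then obtain m where m: "m \<in> {\<delta>..1 - \<delta>}" "\<And>x. x \<in> {\<delta>..1 - \<delta>} \<Longrightarrow> \<phi> m - m \<le> \<phi> x - x"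
    using continuous_attains_inf[of "{\<delta>..1 - \<delta>}" "\<lambda>x. \<phi> x - x"] True by auto
  show ?thesis
  proof (rule that[of "\<phi> m - m"])
    show "0 < \<phi> m - m" using m(1) above assms by auto
    show "x + (\<phi> m - m) \<le> \<phi> x" if "\<delta> \<le> x" "x \<le> 1 - \<delta>" for x
      using m(2)[of x] that by simp
  qed
next
  case False
  show ?thesis by (rule that[of 1]) (use False in auto)
qed

text \<open>Each step to the left by \<open>\<eta>\<close> costs a factor \<open>1 + r\<close>, so the middle of the interval contributes
  only polynomial growth in \<open>r\<close>.\<close>
lemma psum_middle:
  assumes r: "0 \<le> r" and \<delta>: "0 < \<delta>" and \<eta>: "0 < \<eta>" "\<And>x. \<delta> \<le> x \<Longrightarrow> x \<le> 1 - \<delta> \<Longrightarrow> x + \<eta> \<le> \<phi> x"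
    and x: "\<delta> \<le> x" "x \<le> 1" "1 - \<delta> - real k * \<eta> \<le> x"
  shows "psum r N x \<le> (1 + r) ^ k * exp (r * \<delta>)"
  using x
proof (induction k arbitrary: x N)
  case 0
  \<comment> \<open>Gronwall up to \<open>b = 1\<close>, where the tail integral vanishes and
    \<open>B = 1\<close>; the remaining length \<open>1 - x\<close> is at most
    \<open>\<delta>\<close>.\<close>
  have "psum r N x \<le> 1 * exp (r * (1 - x))"
    by (rule psum_gronwall) (use r 0 \<delta> in auto)
  also have "\<dots> \<le> exp (r * \<delta>)" using 0 r by (simp add: mult_left_mono)
  finally show ?case by simp
next
  case (Suc k)
  have ge1: "1 \<le> (1 + r) ^ k * exp (r * \<delta>)"
    using r \<delta> by (simp add: one_le_power mult_ge1_I)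
  have le: "(1 + r) ^ k * exp (r * \<delta>) \<le> (1 + r) ^ Suc k * exp (r * \<delta>)"
    using r by (intro mult_right_mono power_increasing) auto
  have x01: "x \<in> {0..1}" using Suc.prems \<delta> by auto
  show ?case
  proof (cases "x \<le> 1 - \<delta>")
    case True
    have p: "x + \<eta> \<le> \<phi> x" "\<phi> x \<le> 1" "0 \<le> \<phi> x" using \<eta>(2) Suc.prems True phi_bounds[OF x01] by auto
    \<comment> \<open>Adding a term makes the recursion \<open>psum_Suc\<close> applicable for every
      \<open>N\<close>.\<close>
    have "psum r N x \<le> psum r (Suc N) x" using r x01 by (rule psum_mono_Suc)
    also have "\<dots> = 1 + r * integral {\<phi> x..1} (psum r N)" using x01 by (rule psum_Suc)
    also have "\<dots> \<le> 1 + r * psum r N (\<phi> x)"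
      using r p by (intro add_left_mono mult_left_mono psum_integral_tail) auto
    also have "\<dots> \<le> 1 + r * ((1 + r) ^ k * exp (r * \<delta>))"
      using Suc.prems p \<eta>(1) r by (intro add_left_mono mult_left_mono Suc.IH) (auto simp: algebra_simps)
    also have "\<dots> \<le> (1 + r) ^ k * exp (r * \<delta>) + r * ((1 + r) ^ k * exp (r * \<delta>))"
      using ge1 by simp
    also have "\<dots> = (1 + r) ^ Suc k * exp (r * \<delta>)" by (simp add: algebra_simps)
    finally show ?thesis .
  next
    case False
    have "0 \<le> real k * \<eta>" using \<eta> by simp
    then have "1 - \<delta> - real k * \<eta> \<le> x" using False by linarith
    then have "psum r N x \<le> (1 + r) ^ k * exp (r * \<delta>)" using Suc.prems by (intro Suc.IH) auto
    then show ?thesis using le by linarith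
  qed
qed

text \<open>Each end interval of length \<open>\<delta>\<close> contributes
  \<open>exp (\<delta> * r)\<close> by Gronwall, and the middle contributes
  \<open>(1 + r) ^ k\<close>. Two further factors \<open>1 + r\<close> come from joining the pieces
  at \<open>\<delta>\<close> and from the outer integral defining \<open>fcoeff\<close>.\<close>

lemma fcoeff_poly_growth:
  assumes \<delta>: "0 < \<delta>" "\<delta> \<le> 1"
  obtains k where "\<And>r N. 0 \<le> r \<Longrightarrow> (\<Sum>n<N. fcoeff n * r ^ n) \<le> (1 + r) ^ k * exp (2 * \<delta> * r)"
proof -
  obtain \<eta> where \<eta>: "0 < \<eta>" "\<And>x. \<delta> \<le> x \<Longrightarrow> x \<le> 1 - \<delta> \<Longrightarrow> x + \<eta> \<le> \<phi> x"
    using phi_gap[OF \<delta>(1)] by blast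
  \<comment> \<open>With \<open>k * \<eta>\<close> at least 1, \<open>k\<close> steps lead from
    \<open>1 - \<delta>\<close> down past \<open>\<delta>\<close>.\<close>
  obtain k where k: "1 / \<eta> \<le> real k" using real_arch_simple by blast
  then have k1: "1 \<le> real k * \<eta>" using \<eta> by (simp add: field_simps)
  have "(\<Sum>n<N. fcoeff n * r ^ n) \<le> (1 + r) ^ (k + 2) * exp (2 * \<delta> * r)" if r: "0 \<le> r" for r N
  proof -
    define B where "B = (1 + r) ^ Suc k * exp (r * \<delta>)"
    have ge1: "1 \<le> (1 + r) ^ j * exp (r * \<delta>)" for j
      using r \<delta> by (simp add: one_le_power mult_ge1_I)
    have "1 + r * integral {\<delta>..1} (psum r N) \<le> B" for N
    proof -
      have "1 + r * integral {\<delta>..1} (psum r N) \<le> 1 + r * psum r N \<delta>"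
        using r \<delta> by (intro add_left_mono mult_left_mono psum_integral_tail) auto
      also have "\<dots> \<le> 1 + r * ((1 + r) ^ k * exp (r * \<delta>))"
        using r \<delta> k1 by (intro add_left_mono mult_left_mono psum_middle[OF r \<delta>(1) \<eta>]) auto
      also have "\<dots> \<le> (1 + r) ^ k * exp (r * \<delta>) + r * ((1 + r) ^ k * exp (r * \<delta>))"
        using ge1[of k] by simp
      also have "\<dots> = B" by (simp add: B_def algebra_simps)
      finally show ?thesis .
    qed
    then have U0: "psum r N 0 \<le> B * exp (r * (\<delta> - 0))" for N
      by (intro psum_gronwall) (use r \<delta> in auto)
    have BE: "B * exp (r * \<delta>) = (1 + r) ^ Suc k * exp (2 * \<delta> * r)"
      unfolding B_def by (simp add: mult.assoc flip: exp_add)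
    have ge2: "1 \<le> B * exp (r * \<delta>)"
      unfolding BE using r \<delta> by (intro mult_ge1_I one_le_power) auto
    have "(\<Sum>n<N. fcoeff n * r ^ n) \<le> (\<Sum>n<Suc N. fcoeff n * r ^ n)"
      using fcoeff_bounds r by simp
    also have "\<dots> = 1 + r * integral {0..1} (psum r N)"
      by (subst sum.lessThan_Suc_shift) (simp add: psum_integral sum_distrib_left mult_ac)
    also have "\<dots> \<le> 1 + r * psum r N 0"
      using r by (intro add_left_mono mult_left_mono psum_integral_tail) auto
    also have "\<dots> \<le> 1 + r * (B * exp (r * \<delta>))"
      using r U0[of N] by (intro add_left_mono mult_left_mono) auto
    also have "\<dots> \<le> (1 + r) * (B * exp (r * \<delta>))" using ge2 by (simp add: distrib_right)
    also have "\<dots> = (1 + r) ^ (k + 2) * exp (2 * \<delta> * r)" unfolding BE by simp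
    finally show ?thesis .
  qed
  then show ?thesis using that by blast
qed

text \<open>The polynomial factor is absorbed by \<open>1 + r \<le> exp (e' * (1 + r)) / e'\<close>.
  The exponent splits into thirds: two are \<open>2 * e * r\<close> from the previous lemma, one
  pays for the power.\<close>

lemma fcoeff_exp_growth:
  assumes "0 < \<delta>"
  obtains C where "\<And>r N. 0 \<le> r \<Longrightarrow> (\<Sum>n<N. fcoeff n * r ^ n) \<le> C * exp (\<delta> * r)"
proof -
  define e where "e = min (\<delta> / 3) 1"
  have e: "0 < e" "e \<le> 1" "3 * e \<le> \<delta>" using assms by (auto simp: e_def min_def)
  obtain k where k: "\<And>r N. 0 \<le> r \<Longrightarrow> (\<Sum>n<N. fcoeff n * r ^ n) \<le> (1 + r) ^ k * exp (2 * e * r)"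
    using fcoeff_poly_growth[OF e(1,2)] by blast
  define e' where "e' = e / (real k + 1)"
  have e': "e' > 0" "real k * e' \<le> e" using e by (auto simp: e'_def field_simps)
  have "(\<Sum>n<N. fcoeff n * r ^ n) \<le> (exp e / e' ^ k) * exp (\<delta> * r)" if r: "0 \<le> r" for r N
  proof -
    have "1 + r \<le> exp (e' * (1 + r)) / e'"
    proof -
      have "e' * (1 + r) \<le> exp (e' * (1 + r))" using exp_ge_add_one_self[of "e' * (1 + r)"] by linarith
      then show ?thesis using e'(1) by (simp add: pos_le_divide_eq mult.commute)
    qed
    then have "(1 + r) ^ k \<le> (exp (e' * (1 + r)) / e') ^ k" using r by (intro power_mono) auto
    also have "\<dots> = exp (real k * e' * (1 + r)) / e' ^ k"
      by (simp add: power_divide mult.assoc flip: exp_of_nat_mult)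
    also have "\<dots> \<le> exp (e * (1 + r)) / e' ^ k"
      using e' r by (intro divide_right_mono) (auto intro!: mult_right_mono)
    finally have "(1 + r) ^ k * exp (2 * e * r) \<le> exp (e * (1 + r)) / e' ^ k * exp (2 * e * r)"
      by (rule mult_right_mono) simp
    also have "\<dots> = (exp e / e' ^ k) * exp (3 * e * r)"
      by (simp add: exp_add[symmetric] algebra_simps)
    also have "\<dots> \<le> (exp e / e' ^ k) * exp (\<delta> * r)"
      using e e' r by (intro mult_left_mono) (auto intro!: mult_right_mono)
    finally show ?thesis using k[OF r, of N] by linarith
  qed
  then show ?thesis using that by blast
qed

text \<open>A continuous nonnegative function that is positive at the left end has positive
  integral. If \<open>\<phi> 0 = 0\<close>, positivity at the single point 0 propagates; otherwise
  \<open>\<phi>\<close> stays below 1 left of 1, and the iterates remain positive on all of that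
  half-open interval.\<close>

lemma fcoeff_pos:
  assumes "\<phi> 0 = 0 \<or> (\<forall>\<epsilon>\<in>{0<..<1}. \<phi> (1 - \<epsilon>) \<noteq> 1)"
  shows "0 < fcoeff n"
proof -
  have integral_pos: "0 < integral {a..1} (w n)" if "0 \<le> a" "a < 1" "0 < w n a" for a n
  proof -
    have "0 \<le> integral {a..1} (w n)" using that by (intro w_integral_bounds) auto
    moreover have "integral {a..1} (w n) \<noteq> 0"
    proof
      assume z: "integral {a..1} (w n) = 0"
      have "(w n has_integral 0) (cbox a 1)"
        using integrable_integral[OF w_int[of a 1 n]] that z by simp
      then have "w n a = 0"
        by (rule has_integral_0_cbox_imp_0[rotated 2])
           (use that w_bounds w_cont_sub[of a 1 n] in auto)
      with that show False by simp
    qed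
    ultimately show ?thesis by linarith
  qed
  have "0 < w n 0" for n
  proof (cases "\<phi> 0 = 0")
    case True
    show ?thesis by (induction n) (auto simp: True intro: integral_pos)
  next
    case False
    have lt1: "\<phi> x < 1" if x: "0 \<le> x" "x < 1" for x
    proof -
      \<comment> \<open>The hypothesis concerns \<open>1 - \<epsilon>\<close> with
        \<open>\<epsilon>\<close> strictly inside the unit interval, so \<open>x = 0\<close> is
        first moved to an interior point.\<close>
      define y where "y = max x (1/2)"
      have y: "0 < y" "y < 1" "x \<le> y" using x by (auto simp: y_def)
      then have "\<phi> (1 - (1 - y)) \<noteq> 1" using assms False by (metis greaterThanLessThan_iff diff_gt_0_iff_gt diff_less_eq less_add_same_cancel1)
      then have "\<phi> y < 1" using phi_bounds[of y] y by fastforce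
      then show ?thesis using phi_mono[of x y] y x by simp
    qed
    have "0 < w n x" if "0 \<le> x" "x < 1" for x
      using that
    proof (induction n arbitrary: x)
      case (Suc n)
      have "0 \<le> \<phi> x" "\<phi> x < 1" using phi_bounds[of x] lt1 Suc.prems by auto
      then show ?case using integral_pos[OF _ _ Suc.IH] by simp
    qed simp
    then show ?thesis by simp
  qed
  then show ?thesis using integral_pos[of 0] by (cases n) auto
qed

end

section \<open>The determinant\<close>

lemma higher_deriv_powser:
  fixes c :: "nat \<Rightarrow> complex"
  assumes "\<And>z. summable (\<lambda>n. c n * z ^ n)"
  shows "(\<forall>z. summable (\<lambda>n. (diffs ^^ j) c n * z ^ n)) \<and>
         (deriv ^^ j) (\<lambda>z. \<Sum>n. c n * z ^ n) = (\<lambda>z. \<Sum>n. (diffs ^^ j) c n * z ^ n)"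
proof (induction j)
  case (Suc j)
  have "(deriv ^^ Suc j) (\<lambda>z. \<Sum>n. c n * z ^ n) = deriv (\<lambda>z. \<Sum>n. (diffs ^^ j) c n * z ^ n)"
    using Suc by simp
  also have "\<dots> = (\<lambda>z. \<Sum>n. (diffs ^^ Suc j) c n * z ^ n)"
    using termdiffs_strong_converges_everywhere[of "(diffs ^^ j) c"] Suc
    by (auto intro!: ext DERIV_imp_deriv)
  finally show ?case using termdiff_converges_all[of "(diffs ^^ j) c"] Suc by simp
qed (use assms in simp)

lemma diffs_funpow:
  fixes c :: "nat \<Rightarrow> complex"
  shows "(diffs ^^ j) c n = fact (n + j) / fact n * c (n + j)"
proof (induction j arbitrary: n)
  case (Suc j)
  have "(diffs ^^ Suc j) c n = of_nat (Suc n) * (fact (Suc n + j) / fact (Suc n) * c (Suc n + j))"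
    unfolding Suc[of "Suc n", symmetric] by (simp add: diffs_def[of "(diffs ^^ j) c"])
  also have "\<dots> = fact (n + Suc j) / fact n * c (n + Suc j)"
  proof -
    have "of_nat (Suc n) / fact (Suc n) = (1 / fact n :: complex)" by (simp del: of_nat_Suc)
    then have "of_nat (Suc n) * (a / fact (Suc n)) = (a / fact n :: complex)" for a
      by (metis (no_types, opaque_lifting) mult.commute mult.right_neutral times_divide_eq_left times_divide_eq_right)
    then show ?thesis by (metis (no_types, lifting) add_Suc_shift mult.assoc)
  qed
  finally show ?case .
qed simp

context volterra
begin

definition fdet :: "complex \<Rightarrow> complex" where
  "fdet z = (\<Sum>n. ((-1) ^ n * of_real (fcoeff n)) * z ^ n)"

lemma fcoeff_le_fact: "fcoeff (Suc n) \<le> 1 / fact n"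
  using w_integral_bounds(2)[of 0 1 n] by simp

lemma fcoeff_summable: "summable (\<lambda>n. fcoeff n * r ^ n)" if r: "0 \<le> r"
proof -
  have le: "norm (fcoeff (Suc n) * r ^ Suc n) \<le> r * (r ^ n / fact n)" for n
    using mult_right_mono[OF fcoeff_le_fact[of n], of "r ^ Suc n"] fcoeff_bounds[of "Suc n"] r
    by (simp add: abs_mult mult_ac del: fcoeff_simps)
  have "summable (\<lambda>n. r * (r ^ n / fact n))"
    using summable_exp_generic[of r] by (intro summable_mult) (simp add: divide_inverse mult.commute)
  then have "summable (\<lambda>n. fcoeff (Suc n) * r ^ Suc n)"
    by (rule summable_comparison_test[rotated]) (use le in blast)
  then show ?thesis by (subst summable_Suc_iff[symmetric])
qed

lemma fdet_summable: "summable (\<lambda>n. ((-1) ^ n * of_real (fcoeff n)) * (z::complex) ^ n)"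
  by (rule summable_norm_cancel)
     (use fcoeff_summable[of "cmod z"] fcoeff_bounds in \<open>simp add: norm_mult norm_power\<close>)

lemma fdet_holomorphic: "fdet holomorphic_on UNIV"
  unfolding holomorphic_on_def
  using termdiffs_strong_converges_everywhere[OF fdet_summable] unfolding fdet_def[abs_def, symmetric]
  by (auto simp: field_differentiable_def)

lemma fdet_0: "fdet 0 = 1"
  by (simp add: fdet_def)

lemma fdet_deriv: "(deriv ^^ j) fdet z = (\<Sum>n. (fact (n + j) / fact n * ((-1) ^ (n + j) * of_real (fcoeff (n + j)))) * z ^ n)"
  using higher_deriv_powser[OF fdet_summable, of j] unfolding fdet_def[abs_def, symmetric] diffs_funpow by simp

lemma fdet_deriv_at_0: "(deriv ^^ j) fdet 0 = fact j * ((-1) ^ j * of_real (fcoeff j))"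
  unfolding fdet_deriv powser_zero by simp

lemma fdet_deriv_one: "deriv fdet 0 = - 1"
  using fdet_deriv_at_0[of 1] by simp

lemma fdet_growth:
  assumes "0 < \<delta>"
  shows "\<exists>C. \<forall>z. cmod (fdet z) \<le> C * exp (\<delta> * cmod z)"
proof -
  obtain C where C: "\<And>r N. 0 \<le> r \<Longrightarrow> (\<Sum>n<N. fcoeff n * r ^ n) \<le> C * exp (\<delta> * r)"
    using fcoeff_exp_growth[OF assms] by blast
  have "cmod (fdet z) \<le> C * exp (\<delta> * cmod z)" for z
  proof -
    have eq: "cmod (((-1) ^ n * of_real (fcoeff n)) * z ^ n) = fcoeff n * cmod z ^ n" for n
      using fcoeff_bounds by (simp add: norm_mult norm_power)
    have "cmod (fdet z) \<le> (\<Sum>n. fcoeff n * cmod z ^ n)"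
      unfolding fdet_def using summable_norm[of "\<lambda>n. ((-1) ^ n * of_real (fcoeff n)) * z ^ n"] fcoeff_summable[of "cmod z"]
      by (simp only: eq norm_ge_zero)
    also have "\<dots> \<le> C * exp (\<delta> * cmod z)"
      by (rule suminf_le_const[OF fcoeff_summable]) (use C in auto)
    finally show ?thesis .
  qed
  then show ?thesis by blast
qed

text \<open>Coefficients of the \<open>j\<close>-th Taylor coefficient at \<open>z\<close> of the resolvent function \<open>\<zeta> \<mapsto> \<Sum> (- \<zeta>)\<^sup>n W\<^sup>n 1\<close>.
  For \<open>n < j\<close> the binomial coefficient vanishes, so the truncated \<open>n - j\<close> is harmless.\<close>
definition jet :: "complex \<Rightarrow> nat \<Rightarrow> nat \<Rightarrow> complex" where
  "jet z j n = (-1) ^ n * of_nat (n choose j) * z ^ (n - j)"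

lemma jet_zero: "n < j \<Longrightarrow> jet z j n = 0"
  by (simp add: jet_def binomial_eq_0)

lemma admissible_jet: "admissible (jet z j)"
proof -
  have "cmod (jet z j (n + j)) / fact (n + j) = (1 / fact j) * (cmod z ^ n / fact n)" for n
    by (simp add: jet_def norm_mult norm_power norm_divide binomial_fact)
  moreover have "summable (\<lambda>n. (1 / fact j) * (cmod z ^ n / fact n))"
    using summable_exp_generic[of "cmod z"] by (intro summable_mult) (simp add: divide_inverse mult.commute)
  ultimately have "summable (\<lambda>n. cmod (jet z j (n + j)) / fact (n + j))" by simp
  then show ?thesis unfolding admissible_def by (subst (asm) summable_iff_shift)
qed

text \<open>Up to a shift by \<open>j\<close>, this is the termwise derivative of the determinant;
  the skipped terms vanish by \<open>jet_zero\<close>.\<close>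

lemma jet_sums: "(\<lambda>n. jet z j n * of_real (fcoeff n)) sums ((deriv ^^ j) fdet z / fact j)"
proof -
  have "summable (\<lambda>n. (fact (n + j) / fact n * ((-1) ^ (n + j) * of_real (fcoeff (n + j)))) * z ^ n)"
    using higher_deriv_powser[OF fdet_summable, of j] unfolding diffs_funpow by simp
  then have "(\<lambda>n. (fact (n + j) / fact n * ((-1) ^ (n + j) * of_real (fcoeff (n + j)))) * z ^ n / fact j)
     sums ((deriv ^^ j) fdet z / fact j)"
    unfolding fdet_deriv by (intro sums_divide summable_sums)
  moreover have "(fact (n + j) / fact n * ((-1) ^ (n + j) * of_real (fcoeff (n + j)))) * z ^ n / fact j
      = jet z j (n + j) * of_real (fcoeff (n + j))" for n
    by (simp add: jet_def binomial_fact mult_ac)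
  ultimately have "(\<lambda>n. jet z j (n + j) * of_real (fcoeff (n + j))) sums ((deriv ^^ j) fdet z / fact j)"
    by simp
  then show ?thesis by (subst (asm) sums_zero_iff_shift) (simp_all add: jet_zero)
qed

lemma Vcoeff_0_sums: "admissible c \<Longrightarrow> (\<lambda>n. c n * of_real (fcoeff (Suc n))) sums Vcoeff c 0"
  using w_integral_bounds[of 0 1] by (auto intro!: summable_sums admissible_mult_bounded)

text \<open>With \<open>v j\<close> the function of \<open>jet z j\<close>, this is the coefficient
  form of \<open>(1 - z V) (v j) = V (v (j - 1)) + D_j\<close>, where the constant
  \<open>D_j\<close> is the Taylor coefficient of \<open>fdet\<close> at \<open>z\<close>. For
  positive \<open>k\<close> it is Pascal's rule; for \<open>k = 0\<close> it is Pascal's rule summed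
  against \<open>fcoeff\<close>. At a zero of order \<open>m\<close> the constant vanishes for
  \<open>j < m\<close> but not for \<open>j = m\<close>.\<close>

lemma jet_recurrence:
  "jet z j k - z * Vcoeff (jet z j) k - (if j = 0 then 0 else Vcoeff (jet z (j - 1)) k)
     = (if k = 0 then (deriv ^^ j) fdet z / fact j else 0)"
proof -
  have pascal: "jet z j (Suc n) + z * jet z j n + (if j = 0 then 0 else jet z (j - 1) n) = 0" for n
  proof (cases j)
    case 0 then show ?thesis by (simp add: jet_def)
  next
    case (Suc i)
    consider "n < i" | "n = i" | "i < n" by linarith
    then show ?thesis
    proof cases
      case 3
      then have "n - i = Suc (n - Suc i)" by simp
      then show ?thesis using Suc by (simp add: jet_def algebra_simps)
    qed (use Suc in \<open>auto simp: jet_def binomial_eq_0\<close>)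
  qed
  show ?thesis
  proof (cases k)
    case (Suc n)
    then show ?thesis using pascal[of n] by (cases j) (auto simp: algebra_simps)
  next
    case 0
    have c0: "jet z j 0 = (if j = 0 then 1 else 0)" by (cases j) (auto simp: jet_def)
    have "(\<lambda>n. z * (jet z j n * of_real (fcoeff (Suc n)))) sums (z * Vcoeff (jet z j) 0)"
      by (intro sums_mult Vcoeff_0_sums admissible_jet)
    moreover have "(\<lambda>n. if j = 0 then 0 else jet z (j - 1) n * of_real (fcoeff (Suc n))) sums (if j = 0 then 0 else Vcoeff (jet z (j - 1)) 0)"
      using Vcoeff_0_sums[OF admissible_jet] by (cases j) (auto simp del: Vcoeff_simps fcoeff_simps)
    ultimately have "(\<lambda>n. z * (jet z j n * of_real (fcoeff (Suc n))) + (if j = 0 then 0 else jet z (j - 1) n * of_real (fcoeff (Suc n))))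
       sums (z * Vcoeff (jet z j) 0 + (if j = 0 then 0 else Vcoeff (jet z (j - 1)) 0))"
      by (rule sums_add)
    moreover have "z * (jet z j n * of_real (fcoeff (Suc n))) + (if j = 0 then 0 else jet z (j - 1) n * of_real (fcoeff (Suc n)))
        = - (jet z j (Suc n) * of_real (fcoeff (Suc n)))" for n
    proof -
      have "jet z j (Suc n) = - (z * jet z j n + (if j = 0 then 0 else jet z (j - 1) n))"
        using pascal[of n] by (simp add: add_eq_0_iff2 add.assoc eq_neg_iff_add_eq_0)
      then show ?thesis by (simp only: distrib_right mult_minus_left minus_minus) (auto simp: algebra_simps simp del: fcoeff_simps)
    qed
    ultimately have 1: "(\<lambda>n. - (jet z j (Suc n) * of_real (fcoeff (Suc n)))) sums
        (z * Vcoeff (jet z j) 0 + (if j = 0 then 0 else Vcoeff (jet z (j - 1)) 0))" by simp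
    have 2: "(\<lambda>n. jet z j (Suc n) * of_real (fcoeff (Suc n))) sums ((deriv ^^ j) fdet z / fact j - jet z j 0 * of_real (fcoeff 0))"
      using jet_sums[of z j] by (subst sums_Suc_iff) simp
    have "- ((deriv ^^ j) fdet z / fact j - jet z j 0 * of_real (fcoeff 0)) = z * Vcoeff (jet z j) 0 + (if j = 0 then 0 else Vcoeff (jet z (j - 1)) 0)"
      using sums_minus[OF 2] 1 sums_unique2 by blast
    then show ?thesis using 0 by (simp add: algebra_simps del: Vcoeff_simps)
  qed
qed

end

section \<open>Eigenfunctions and Jordan chains\<close>

abbreviation integrable01 :: "(real \<Rightarrow> complex) \<Rightarrow> bool" where
  "integrable01 g \<equiv> set_integrable lborel {0..1} g"

lemma ae_eq01_E: "ae_eq01 f g \<Longrightarrow> AE x in lborel. x \<in> {0..1} \<longrightarrow> f x = g x"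
  by (simp add: ae_eq01_def)

text \<open>On a set of finite measure \<open>cmod (f x) \<le> 1 + (cmod (f x))\<^sup>2\<close>
  suffices. The uniqueness arguments below are carried out for integrable functions.\<close>

lemma L2_01_integrable:
  assumes "f \<in> L2_01" shows "integrable01 f"
proof -
  have f: "f \<in> borel_measurable lborel" "set_integrable lborel {0..1} (\<lambda>x. (cmod (f x))\<^sup>2)"
    using assms by (auto simp: L2_01_def)
  have "set_integrable lborel {0..1} (\<lambda>x. 1 + (cmod (f x))\<^sup>2)"
    by (intro set_integral_add f borel_integrable_atLeastAtMost') auto
  then show ?thesis
  proof (rule set_integrable_bound)
    show "set_borel_measurable lborel {0..1} f"
      using f(1) unfolding set_borel_measurable_def by measurable
    have "cmod (f x) \<le> 1 + (cmod (f x))\<^sup>2" for x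
      using zero_le_power2[of "cmod (f x) - 1/2"] by (simp add: power2_eq_square algebra_simps)
    then show "AE x in lborel. x \<in> {0..1} \<longrightarrow> cmod (f x) \<le> norm (1 + (cmod (f x))\<^sup>2)" by simp
  qed
qed

lemma integrable01_sub:
  "integrable01 g \<Longrightarrow> 0 \<le> a \<Longrightarrow> b \<le> 1 \<Longrightarrow> set_integrable lborel {a..b} g"
  by (rule set_integrable_subset) auto

lemma integral_split01:
  assumes "integrable01 g" "0 \<le> y" "y \<le> 1"
  shows "(LINT t:{0..y}|lborel. g t) = (LINT t:{0..1}|lborel. g t) - (LINT t:{y..1}|lborel. g t)"
  using assms Henstock_Kurzweil_Integration.integral_combine[OF assms(2,3) set_borel_integral_eq_integral(1)[OF assms(1)]]
  by (simp add: set_borel_integral_eq_integral(2) integrable01_sub algebra_simps)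

lemma set_integral_cong01:
  assumes f: "integrable01 f" and g: "integrable01 g"
    and eq: "AE x in lborel. x \<in> {0..1} \<longrightarrow> f x = g x" and ab: "0 \<le> a" "b \<le> 1"
  shows "(LINT t:{a..b}|lborel. f t) = (LINT t:{a..b}|lborel. g t)"
  unfolding set_lebesgue_integral_def
proof (rule integral_cong_AE)
  show "(\<lambda>x. indicator {a..b} x *\<^sub>R f x) \<in> borel_measurable lborel" "(\<lambda>x. indicator {a..b} x *\<^sub>R g x) \<in> borel_measurable lborel"
    using integrable01_sub[OF f ab] integrable01_sub[OF g ab] by (auto simp: set_integrable_def)
  show "AE x in lborel. indicator {a..b} x *\<^sub>R f x = indicator {a..b} x *\<^sub>R g x"
    using eq by eventually_elim (use ab in \<open>auto simp: indicator_def\<close>)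
qed

lemma norm_set_integral_tail:
  assumes e: "integrable01 e" and ab: "0 \<le> a" "a \<le> b" "b \<le> 1"
  shows "cmod (LINT t:{b..1}|lborel. e t) \<le> (LINT t:{a..1}|lborel. cmod (e t))"
proof -
  have n: "set_integrable lborel {c..1} (\<lambda>t. cmod (e t))" if "0 \<le> c" for c
    using integrable01_sub[OF e that, of 1] by (intro set_integrable_norm) auto
  have "cmod (LINT t:{b..1}|lborel. e t) \<le> (LINT t:{b..1}|lborel. cmod (e t))"
    using ab by (intro set_integral_norm_bound integrable01_sub[OF e]) auto
  also have "\<dots> \<le> (LINT t:{a..1}|lborel. cmod (e t))"
    using ab n[of a] n[of b] set_borel_integral_eq_integral[OF n]
    by (simp add: integral_subset_le)
  finally show ?thesis .
qed

text \<open>Gaussian elimination: \<open>m\<close> homogeneous equations in more than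
  \<open>m\<close> unknowns have a nontrivial solution. The pivot \<open>p\<close> removes one
  equation and one unknown, and its value \<open>- s\<close> is then recovered from equation
  \<open>m\<close>.\<close>

lemma ex_linear_dependency:
  fixes A :: "'i \<Rightarrow> nat \<Rightarrow> complex"
  assumes "finite R" "m < card R"
  shows "\<exists>c. (\<exists>i\<in>R. c i \<noteq> 0) \<and> (\<forall>j<m. (\<Sum>i\<in>R. c i * A i j) = 0)"
  using assms
proof (induction m arbitrary: R A)
  case 0
  then have "\<exists>i. i \<in> R" by (metis card.empty ex_in_conv less_irrefl)
  then show ?case by (intro exI[of _ "\<lambda>_. 1"]) auto
next
  case (Suc m)
  show ?case
  proof (cases "\<forall>i\<in>R. A i m = 0")
    case True
    obtain c where "\<exists>i\<in>R. c i \<noteq> 0" "\<forall>j<m. (\<Sum>i\<in>R. c i * A i j) = 0"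
      using Suc.IH[of R A] Suc.prems by auto
    then show ?thesis using True by (intro exI[of _ c]) (auto simp: less_Suc_eq)
  next
    case False
    then obtain p where p: "p \<in> R" "A p m \<noteq> 0" by auto
    define B where "B = (\<lambda>i j. A i j - A i m / A p m * A p j)"
    have "m < card (R - {p})" using Suc.prems p by (simp add: card_Diff_singleton)
    then obtain c where c: "\<exists>i\<in>R - {p}. c i \<noteq> 0" "\<And>j. j < m \<Longrightarrow> (\<Sum>i\<in>R - {p}. c i * B i j) = 0"
      using Suc.IH[of "R - {p}" B] Suc.prems by auto
    define s where "s = (\<Sum>i\<in>R - {p}. c i * (A i m / A p m))"
    define e where "e = (\<lambda>i. if i = p then - s else c i)"
    have eq: "(\<Sum>i\<in>R. e i * A i j) = (\<Sum>i\<in>R - {p}. c i * B i j)" for j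
    proof -
      have "(\<Sum>i\<in>R. e i * A i j) = - s * A p j + (\<Sum>i\<in>R - {p}. c i * A i j)"
        using Suc.prems p by (subst sum.remove[of _ p]) (auto simp: e_def intro!: sum.cong)
      also have "\<dots> = (\<Sum>i\<in>R - {p}. c i * B i j)"
        by (simp add: B_def s_def sum_distrib_right sum_distrib_left sum_subtractf algebra_simps)
      finally show ?thesis .
    qed
    have "(\<Sum>i\<in>R - {p}. c i * B i m) = 0" using p by (simp add: B_def)
    then have "\<forall>j<Suc m. (\<Sum>i\<in>R. e i * A i j) = 0" using c(2) eq by (auto simp: less_Suc_eq)
    moreover have "\<exists>i\<in>R. e i \<noteq> 0" using c(1) by (auto simp: e_def)
    ultimately show ?thesis by blast
  qed
qed

section \<open>Uniqueness for the resolvent equation; eigenvalues as reciprocal zeros\<close>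

context volterra
begin

lemma Vphi_alt:
  "integrable01 g \<Longrightarrow> x \<in> {0..1} \<Longrightarrow>
     Vphi \<phi> g x = (LINT t:{0..1}|lborel. g t) - (LINT t:{\<phi> x..1}|lborel. g t)"
  unfolding Vphi_def using phi_bounds by (intro integral_split01) auto

lemma Vphi_integrable:
  assumes "integrable01 g" shows "integrable01 (Vphi \<phi> g)"
proof -
  have "continuous_on {0..1} (\<lambda>y. integral {0..y} g)"
    by (intro indefinite_integral_continuous_1 set_borel_integral_eq_integral(1) assms)
  then have "continuous_on {0..1} (\<lambda>x. integral {0..\<phi> x} g)"
    by (rule continuous_on_compose2[OF _ cont]) (use maps in auto)
  moreover have "Vphi \<phi> g x = integral {0..\<phi> x} g" if "x \<in> {0..1}" for x
    unfolding Vphi_def using phi_bounds[OF that]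
    by (intro set_borel_integral_eq_integral(2) integrable01_sub[OF assms]) auto
  ultimately have "continuous_on {0..1} (Vphi \<phi> g)" using continuous_on_eq by (metis (no_types, lifting))
  then show ?thesis by (rule borel_integrable_atLeastAtMost')
qed

lemma Vphi_cong_AE:
  "integrable01 f \<Longrightarrow> integrable01 g \<Longrightarrow> AE x in lborel. x \<in> {0..1} \<longrightarrow> f x = g x \<Longrightarrow> x \<in> {0..1} \<Longrightarrow>
     Vphi \<phi> f x = Vphi \<phi> g x"
  unfolding Vphi_def using phi_bounds[of x] by (intro set_integral_cong01) auto

lemma Vphi_cong:
  "(\<And>x. x \<in> {0..1} \<Longrightarrow> f x = g x) \<Longrightarrow> x \<in> {0..1} \<Longrightarrow> Vphi \<phi> f x = Vphi \<phi> g x"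
  unfolding Vphi_def using phi_bounds[of x] by (intro set_lebesgue_integral_cong) auto

lemma Vphi_scale: "Vphi \<phi> (\<lambda>x. a * f x) x = a * Vphi \<phi> f x"
  unfolding Vphi_def by simp

lemma Vphi_add:
  assumes "integrable01 f" "integrable01 g" "x \<in> {0..1}"
  shows "Vphi \<phi> (\<lambda>x. f x + g x) x = Vphi \<phi> f x + Vphi \<phi> g x"
  unfolding Vphi_def using phi_bounds[OF assms(3)]
  by (intro set_integral_add(2) integrable01_sub[OF assms(1)] integrable01_sub[OF assms(2)]) auto

lemma integrable01_lin: "integrable01 f \<Longrightarrow> integrable01 g \<Longrightarrow> integrable01 (\<lambda>x. a * f x + b * g x)"
  by (intro set_integral_add set_integrable_mult_right) auto

lemma Vphi_lin:
  assumes "integrable01 f" "integrable01 g" "x \<in> {0..1}"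
  shows "Vphi \<phi> (\<lambda>x. a * f x + b * g x) x = a * Vphi \<phi> f x + b * Vphi \<phi> g x"
  using Vphi_add[of "\<lambda>x. a * f x" "\<lambda>x. b * g x" x] assms by (simp add: Vphi_scale)

lemma integrable01_sum:
  fixes n :: nat
  shows "(\<And>j. j < n \<Longrightarrow> integrable01 (f j)) \<Longrightarrow> integrable01 (\<lambda>x. \<Sum>j<n. a j * f j x)"
proof (induction n)
  case (Suc n)
  then show ?case using integrable01_lin[of "\<lambda>x. \<Sum>j<n. a j * f j x" "f n" 1 "a n"] by simp
qed (simp add: set_integrable_def)

lemma Vphi_sum:
  fixes n :: nat
  shows "(\<And>j. j < n \<Longrightarrow> integrable01 (f j)) \<Longrightarrow> x \<in> {0..1} \<Longrightarrow>
    Vphi \<phi> (\<lambda>x. \<Sum>j<n. a j * f j x) x = (\<Sum>j<n. a j * Vphi \<phi> (f j) x)"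
proof (induction n)
  case 0 show ?case by (simp add: Vphi_def set_lebesgue_integral_def)
next
  case (Suc n)
  then show ?case
    using Vphi_lin[of "\<lambda>x. \<Sum>j<n. a j * f j x" "f n" x 1 "a n"] integrable01_sum[of n f a] by simp
qed

text \<open>This expresses quasinilpotency of \<open>W\<close>: iterating the equation gives a bound
  decaying like \<open>1 / fact n\<close> almost everywhere for each \<open>n\<close>. The countably
  many null sets are merged before \<open>n\<close> tends to infinity.\<close>

lemma volterra_unique:
  assumes e: "integrable01 e"
    and eq: "AE x in lborel. x \<in> {0..1} \<longrightarrow> e x = - z * (LINT t:{\<phi> x..1}|lborel. e t)"
  shows "AE x in lborel. x \<in> {0..1} \<longrightarrow> e x = 0"
proof -
  define M where "M = (LINT t:{0..1}|lborel. cmod (e t))"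
  have bound: "AE x in lborel. x \<in> {0..1} \<longrightarrow> cmod (e x) \<le> M * cmod z ^ Suc n * ((1 - x) ^ n / fact n)" for n
  proof (induction n)
    case 0
    show ?case using eq
    proof eventually_elim
      case (elim x)
      show ?case
      proof
        assume x: "x \<in> {0..1}"
        have "cmod (e x) = cmod z * cmod (LINT t:{\<phi> x..1}|lborel. e t)" using elim x by (simp add: norm_mult)
        also have "\<dots> \<le> cmod z * M"
          unfolding M_def using phi_bounds[OF x] by (intro mult_left_mono norm_set_integral_tail[OF e]) auto
        finally show "cmod (e x) \<le> M * cmod z ^ Suc 0 * ((1 - x) ^ 0 / fact 0)" by (simp add: mult.commute)
      qed
    qed
  next
    case (Suc n)
    have tail: "(LINT t:{x..1}|lborel. cmod (e t)) \<le> M * cmod z ^ Suc n * ((1 - x) ^ Suc n / fact (Suc n))" if x: "x \<in> {0..1}" for x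
    proof -
      let ?q = "\<lambda>t. M * cmod z ^ Suc n * ((1 - t) ^ n / fact n)"
      have qi: "set_integrable lborel {x..1} ?q"
        by (intro borel_integrable_atLeastAtMost' continuous_intros) auto
      have "(LINT t:{x..1}|lborel. cmod (e t)) \<le> (LINT t:{x..1}|lborel. ?q t)"
      proof (rule set_integral_mono_AE)
        show "set_integrable lborel {x..1} (\<lambda>t. cmod (e t))"
          using integrable01_sub[OF e, of x 1] x by (intro set_integrable_norm) auto
        show "AE t\<in>{x..1} in lborel. cmod (e t) \<le> ?q t"
          using Suc by eventually_elim (use x in auto)
      qed (rule qi)
      also have "\<dots> = integral {x..1} ?q" by (rule set_borel_integral_eq_integral(2)[OF qi])
      also have "\<dots> = M * cmod z ^ Suc n * ((1 - x) ^ Suc n / fact (Suc n))"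
        using x by (intro integral_unique has_integral_mult_right has_integral_truncated_power) auto
      finally show ?thesis .
    qed
    show ?case using eq
    proof eventually_elim
      case (elim x)
      show ?case
      proof
        assume x: "x \<in> {0..1}"
        have "cmod (e x) = cmod z * cmod (LINT t:{\<phi> x..1}|lborel. e t)" using elim x by (simp add: norm_mult)
        also have "\<dots> \<le> cmod z * (LINT t:{x..1}|lborel. cmod (e t))"
          using phi_bounds[OF x] phi_ge[OF x] x by (intro mult_left_mono norm_set_integral_tail[OF e]) auto
        also have "\<dots> \<le> cmod z * (M * cmod z ^ Suc n * ((1 - x) ^ Suc n / fact (Suc n)))"
          by (intro mult_left_mono tail x) auto
        finally show "cmod (e x) \<le> M * cmod z ^ Suc (Suc n) * ((1 - x) ^ Suc n / fact (Suc n))"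
          by (simp add: mult_ac)
      qed
    qed
  qed
  then have "AE x in lborel. \<forall>n. x \<in> {0..1} \<longrightarrow> cmod (e x) \<le> M * cmod z ^ Suc n * ((1 - x) ^ n / fact n)"
    unfolding AE_all_countable by blast
  then show ?thesis
  proof eventually_elim
    case (elim x)
    show ?case
    proof
      assume x: "x \<in> {0..1}"
      have "(\<lambda>n. (cmod z * (1 - x)) ^ n / fact n) \<longlonglongrightarrow> 0"
        using summable_LIMSEQ_zero[OF summable_exp_generic[of "cmod z * (1 - x)"]] by (simp add: divide_inverse mult.commute)
      then have "(\<lambda>n. M * cmod z * ((cmod z * (1 - x)) ^ n / fact n)) \<longlonglongrightarrow> M * cmod z * 0"
        by (intro tendsto_mult tendsto_const)
      moreover have "cmod (e x) \<le> M * cmod z * ((cmod z * (1 - x)) ^ n / fact n)" for n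
        using elim x by (simp add: power_mult_distrib mult_ac)
      ultimately have "cmod (e x) \<le> 0" using LIMSEQ_le_const by fastforce
      then show "e x = 0" by simp
    qed
  qed
qed

lemma wser_integrable: "admissible c \<Longrightarrow> integrable01 (wser c)"
  by (rule wser_set_integrable) auto

lemma wser_integral: "admissible c \<Longrightarrow> (LINT t:{0..1}|lborel. wser c t) = Vcoeff c 0"
  using wser_integral_sums[of c 0 1] sums_unique by fastforce

lemma admissible_delta: "admissible (\<lambda>k. if k = 0 then a else 0)"
  unfolding admissible_def by (rule summable_finite[of "{0}"]) auto

lemma wser_delta: "x \<in> {0..1} \<Longrightarrow> wser (\<lambda>k. if k = 0 then a else 0) x = a"
proof -
  assume x: "x \<in> {0..1}"
  have "(\<lambda>n. (if n = 0 then a else 0) * of_real (w n x)) sums (\<Sum>n\<in>{0}. (if n = 0 then a else 0) * of_real (w n x))"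
    by (rule sums_finite) auto
  then show ?thesis using wser_sums[OF admissible_delta[of a] x] sums_unique2 by fastforce
qed

lemma wser_jet:
  assumes "x \<in> {0..1}"
  shows "wser (jet z j) x - z * wser (Vcoeff (jet z j)) x - (if j = 0 then 0 else wser (Vcoeff (jet z (j - 1))) x) = (deriv ^^ j) fdet z / fact j"
proof -
  define e where "e = (if j = 0 then (\<lambda>_. 0) else Vcoeff (jet z (j - 1)))"
  have e: "admissible e" unfolding e_def using admissible_Vcoeff[OF admissible_jet] admissible_delta[of 0] by auto
  define f where "f = (\<lambda>k. z * Vcoeff (jet z j) k + 1 * e k)"
  define h where "h = (\<lambda>k::nat. if k = 0 then (deriv ^^ j) fdet z / fact j else 0)"
  have f: "admissible f" unfolding f_def by (intro admissible_lin admissible_Vcoeff admissible_jet e)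
  have h: "admissible h" unfolding h_def by (rule admissible_delta)
  have "jet z j k = 1 * f k + 1 * h k" for k
    using jet_recurrence[of z j k] by (cases "j = 0") (simp_all add: e_def f_def h_def algebra_simps del: Vcoeff_simps)
  then have "jet z j = (\<lambda>k. 1 * f k + 1 * h k)" by (rule ext)
  then have "wser (jet z j) x = wser (\<lambda>k. 1 * f k + 1 * h k) x" by (simp only:)
  also have "\<dots> = wser f x + wser h x" by (subst wser_lin[OF f h assms]) simp
  also have "wser f x = z * wser (Vcoeff (jet z j)) x + wser e x"
    unfolding f_def by (subst wser_lin[OF admissible_Vcoeff[OF admissible_jet] e assms]) simp
  also have "wser h x = (deriv ^^ j) fdet z / fact j"
    unfolding h_def by (rule wser_delta[OF assms])
  finally show ?thesis by (auto simp: e_def wser_0)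
qed

lemma resolvent_integral_eq: "z * Vcoeff (jet z 0) 0 = 1 - fdet z"
  using jet_recurrence[of z 0 0] by (simp add: jet_def algebra_simps del: Vcoeff_simps)

text \<open>Splitting off the rank-one part turns the equation into \<open>g = K - z W g\<close>,
  while the order-0 jet function solves \<open>u = 1 - z W u\<close>. The difference
  \<open>g - K u\<close> solves the homogeneous Volterra equation and is null.\<close>

lemma resolvent_unique:
  assumes g: "integrable01 g"
    and eq: "AE x in lborel. x \<in> {0..1} \<longrightarrow> g x - z * Vphi \<phi> g x = \<kappa>"
  defines "K \<equiv> \<kappa> + z * (LINT t:{0..1}|lborel. g t)"
  shows "AE x in lborel. x \<in> {0..1} \<longrightarrow> g x = K * wser (jet z 0) x"
proof -
  define u where "u = wser (jet z 0)"
  have u: "integrable01 u" unfolding u_def by (intro wser_integrable admissible_jet)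
  define e where "e = (\<lambda>x. 1 * g x + (- K) * u x)"
  have e: "integrable01 e" unfolding e_def by (intro integrable01_lin g u)
  have ue: "u x = 1 - z * (LINT t:{\<phi> x..1}|lborel. u t)" if x: "x \<in> {0..1}" for x
  proof -
    have "u x - z * Vphi \<phi> u x = fdet z"
      using wser_jet[OF x, of z 0] Vphi_wser[OF admissible_jet x, of z 0] by (simp add: u_def)
    moreover have "Vphi \<phi> u x = Vcoeff (jet z 0) 0 - (LINT t:{\<phi> x..1}|lborel. u t)"
      using Vphi_alt[OF u x] wser_integral[OF admissible_jet, of z 0] by (simp only: u_def)
    ultimately have "u x = fdet z + z * Vcoeff (jet z 0) 0 - z * (LINT t:{\<phi> x..1}|lborel. u t)"
      by (simp add: algebra_simps del: Vcoeff_simps)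
    then show ?thesis unfolding resolvent_integral_eq by simp
  qed
  have "AE x in lborel. x \<in> {0..1} \<longrightarrow> e x = - z * (LINT t:{\<phi> x..1}|lborel. e t)"
    using eq
  proof eventually_elim
    case (elim x)
    show ?case
    proof
      assume x: "x \<in> {0..1}"
      have p: "0 \<le> \<phi> x" using phi_bounds[OF x] by simp
      have "(LINT t:{\<phi> x..1}|lborel. e t) = (LINT t:{\<phi> x..1}|lborel. 1 * g t) + (LINT t:{\<phi> x..1}|lborel. (- K) * u t)"
        unfolding e_def
        using integrable01_sub[OF g p order_refl] integrable01_sub[OF u p order_refl]
        by (intro set_integral_add(2) set_integrable_mult_right)
      also have "\<dots> = (LINT t:{\<phi> x..1}|lborel. g t) - K * (LINT t:{\<phi> x..1}|lborel. u t)"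
        unfolding set_integral_mult_right by simp
      finally have I: "(LINT t:{\<phi> x..1}|lborel. e t) = (LINT t:{\<phi> x..1}|lborel. g t) - K * (LINT t:{\<phi> x..1}|lborel. u t)" .
      have gx: "g x = K - z * (LINT t:{\<phi> x..1}|lborel. g t)"
        using elim x Vphi_alt[OF g x] by (simp add: K_def algebra_simps)
      have "e x = g x - K * u x" by (simp add: e_def)
      also have "\<dots> = (K - z * (LINT t:{\<phi> x..1}|lborel. g t)) - K * (1 - z * (LINT t:{\<phi> x..1}|lborel. u t))"
        by (simp only: gx ue[OF x])
      finally show "e x = - z * (LINT t:{\<phi> x..1}|lborel. e t)"
        unfolding I by (simp add: algebra_simps)
    qed
  qed
  from volterra_unique[OF e this] show ?thesis
    by eventually_elim (auto simp: e_def u_def)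
qed

text \<open>Obtained by integrating \<open>g = K u\<close>, with the integral of \<open>u\<close>
  known from \<open>resolvent_integral_eq\<close>. At a zero of \<open>fdet\<close> it becomes a
  solvability condition: the constant \<open>\<kappa>\<close> must be 0.\<close>

lemma resolvent_integral:
  assumes g: "integrable01 g"
    and eq: "AE x in lborel. x \<in> {0..1} \<longrightarrow> g x - z * Vphi \<phi> g x = \<kappa>"
  shows "(\<kappa> + z * (LINT t:{0..1}|lborel. g t)) * fdet z = \<kappa>"
proof -
  let ?c = "LINT t:{0..1}|lborel. g t"
  let ?K = "\<kappa> + z * ?c"
  have i: "integrable01 (\<lambda>x. ?K * wser (jet z 0) x)"
    by (intro set_integrable_mult_right wser_integrable admissible_jet)
  have "?c = (LINT t:{0..1}|lborel. ?K * wser (jet z 0) t)"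
    by (rule set_integral_cong01[OF g i resolvent_unique[OF g eq]]) auto
  also have "\<dots> = ?K * Vcoeff (jet z 0) 0" unfolding set_integral_mult_right by (simp only: wser_integral[OF admissible_jet])
  finally have "z * ?c = ?K * (1 - fdet z)" using resolvent_integral_eq[of z] by (metis mult.left_commute)
  then show ?thesis by (simp add: algebra_simps)
qed

lemma wser_L2: "admissible c \<Longrightarrow> wser c \<in> L2_01"
proof -
  assume c: "admissible c"
  have "wser c = (\<lambda>x. indicator {0..1} x *\<^sub>R wser c x)" by (auto simp: wser_def indicator_def)
  moreover have "(\<lambda>x. indicator {0..1} x *\<^sub>R wser c x) \<in> borel_measurable borel"
    by (intro borel_measurable_continuous_on_indicator wser_cont c) auto
  ultimately have "wser c \<in> borel_measurable lborel" by simp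
  moreover have "set_integrable lborel {0..1} (\<lambda>x. (cmod (wser c x))\<^sup>2)"
    by (intro borel_integrable_atLeastAtMost' continuous_intros wser_cont c)
  ultimately show ?thesis by (simp add: L2_01_def)
qed

text \<open>A null function would have integral 0, and \<open>resolvent_integral_eq\<close> would
  give \<open>fdet z = 1\<close>.\<close>

lemma eigenfunction_nonzero: "fdet z = 0 \<Longrightarrow> \<not> (AE x in lborel. x \<in> {0..1} \<longrightarrow> wser (jet z 0) x = 0)"
proof
  assume fdet: "fdet z = 0" and 0: "AE x in lborel. x \<in> {0..1} \<longrightarrow> wser (jet z 0) x = 0"
  have "integrable01 (\<lambda>_. 0)" by (simp add: set_integrable_def)
  from set_integral_cong01[OF wser_integrable[OF admissible_jet] this 0, of 0 1]
  have "Vcoeff (jet z 0) 0 = 0" by (simp add: wser_integral[OF admissible_jet] del: Vcoeff_simps)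
  then show False using resolvent_integral_eq[of z] fdet by simp
qed

text \<open>For an eigenfunction \<open>\<kappa> = 0\<close>, so either the determinant vanishes or
  the factor \<open>K\<close> does, and the latter makes the function null. Conversely the order-0
  jet function at a zero is an eigenfunction.\<close>

lemma nonzero_eigs_eq: "nonzero_eigs \<phi> = {\<mu>. \<mu> \<noteq> 0 \<and> fdet (1 / \<mu>) = 0}"
proof (rule set_eqI)
  fix \<mu>
  show "\<mu> \<in> nonzero_eigs \<phi> \<longleftrightarrow> \<mu> \<in> {\<mu>. \<mu> \<noteq> 0 \<and> fdet (1 / \<mu>) = 0}"
  proof
    assume "\<mu> \<in> nonzero_eigs \<phi>"
    then obtain f where \<mu>: "\<mu> \<noteq> 0" and f: "f \<in> L2_01" "\<not> ae_eq01 f (\<lambda>_. 0)" "ae_eq01 (Vphi \<phi> f) (\<lambda>x. \<mu> * f x)"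
      by (auto simp: nonzero_eigs_def)
    have g: "integrable01 f" using f(1) by (rule L2_01_integrable)
    have eq: "AE x in lborel. x \<in> {0..1} \<longrightarrow> f x - (1 / \<mu>) * Vphi \<phi> f x = 0"
      using ae_eq01_E[OF f(3)] by eventually_elim (use \<mu> in auto)
    have "(0 + (1 / \<mu>) * (LINT t:{0..1}|lborel. f t)) * fdet (1 / \<mu>) = 0"
      by (rule resolvent_integral[OF g eq])
    moreover have "0 + (1 / \<mu>) * (LINT t:{0..1}|lborel. f t) \<noteq> 0"
    proof
      assume K: "0 + (1 / \<mu>) * (LINT t:{0..1}|lborel. f t) = 0"
      have "ae_eq01 f (\<lambda>_. 0)"
        using resolvent_unique[OF g eq] unfolding K ae_eq01_def mult_zero_left .
      with f(2) show False ..
    qed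
    ultimately show "\<mu> \<in> {\<mu>. \<mu> \<noteq> 0 \<and> fdet (1 / \<mu>) = 0}" using \<mu> by simp
  next
    assume "\<mu> \<in> {\<mu>. \<mu> \<noteq> 0 \<and> fdet (1 / \<mu>) = 0}"
    then have \<mu>: "\<mu> \<noteq> 0" "fdet (1 / \<mu>) = 0" by auto
    let ?u = "wser (jet (1 / \<mu>) 0)"
    have "Vphi \<phi> ?u x = \<mu> * ?u x" if x: "x \<in> {0..1}" for x
      using wser_jet[OF x, of "1 / \<mu>" 0] Vphi_wser[OF admissible_jet x, of "1 / \<mu>" 0] \<mu> by (simp add: field_simps)
    then have "ae_eq01 (Vphi \<phi> ?u) (\<lambda>x. \<mu> * ?u x)" by (simp add: ae_eq01_def)
    moreover have "\<not> ae_eq01 ?u (\<lambda>_. 0)" using eigenfunction_nonzero[OF \<mu>(2)] by (simp add: ae_eq01_def)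
    ultimately show "\<mu> \<in> nonzero_eigs \<phi>" unfolding nonzero_eigs_def using \<mu>(1) wser_L2[OF admissible_jet] by blast
  qed
qed

end

section \<open>Algebraic multiplicity equals the order of the zero\<close>

lemma alg_mult_eqI:
  assumes span: "\<And>f. f \<in> gen_eigenspace \<phi> \<mu> \<Longrightarrow> \<exists>a. ae_eq01 f (\<lambda>x. \<Sum>j<m. a j * Y j x)"
    and Y: "\<And>j. j < m \<Longrightarrow> Y j \<in> gen_eigenspace \<phi> \<mu>"
    and indep: "\<And>a j. ae_eq01 (\<lambda>x. \<Sum>j<m. a j * Y j x) (\<lambda>_. 0) \<Longrightarrow> j < m \<Longrightarrow> a j = 0"
  shows "alg_mult \<phi> \<mu> = enat m"
proof -
  define N where "N = {enat n | n. \<exists>fs :: nat \<Rightarrow> real \<Rightarrow> complex.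
      (\<forall>i<n. fs i \<in> gen_eigenspace \<phi> \<mu>) \<and>
      (\<forall>c :: nat \<Rightarrow> complex. ae_eq01 (\<lambda>x. \<Sum>i<n. c i * fs i x) (\<lambda>_. 0) \<longrightarrow> (\<forall>i<n. c i = 0))}"
  have "enat m \<in> N" unfolding N_def using Y indep by blast
  moreover have "k \<le> enat m" if k: "k \<in> N" for k
  proof -
    obtain n fs where n: "k = enat n" "\<And>i. i < n \<Longrightarrow> fs i \<in> gen_eigenspace \<phi> \<mu>"
      "\<And>c i. ae_eq01 (\<lambda>x. \<Sum>i<n. c i * fs i x) (\<lambda>_. 0) \<Longrightarrow> i < n \<Longrightarrow> c i = 0"
      using k unfolding N_def by blast
    have "\<forall>i. \<exists>a. i < n \<longrightarrow> ae_eq01 (fs i) (\<lambda>x. \<Sum>j<m. a j * Y j x)"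
      using span n(2) by blast
    then obtain A where A: "\<And>i. i < n \<Longrightarrow> ae_eq01 (fs i) (\<lambda>x. \<Sum>j<m. A i j * Y j x)" by metis
    have "\<not> m < n"
    proof
      assume "m < n"
      \<comment> \<open>A dependency among the coordinate rows gives one among the functions, almost
        everywhere.\<close>
      then obtain c where c: "\<exists>i\<in>{..<n}. c i \<noteq> 0" "\<And>j. j < m \<Longrightarrow> (\<Sum>i<n. c i * A i j) = 0"
        using ex_linear_dependency[of "{..<n}" m A] by auto
      have "AE x in lborel. \<forall>i\<in>{..<n}. x \<in> {0..1} \<longrightarrow> fs i x = (\<Sum>j<m. A i j * Y j x)"
        by (rule AE_finite_allI) (use A in \<open>auto simp: ae_eq01_def\<close>)
      then have "ae_eq01 (\<lambda>x. \<Sum>i<n. c i * fs i x) (\<lambda>_. 0)"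
        unfolding ae_eq01_def
      proof eventually_elim
        case (elim x)
        show ?case
        proof
          assume x: "x \<in> {0..1}"
          have "(\<Sum>i<n. c i * fs i x) = (\<Sum>i<n. \<Sum>j<m. c i * A i j * Y j x)"
            using elim x by (intro sum.cong) (auto simp: sum_distrib_left mult.assoc)
          also have "\<dots> = (\<Sum>j<m. (\<Sum>i<n. c i * A i j) * Y j x)"
            by (subst sum.swap) (simp add: sum_distrib_right)
          also have "\<dots> = 0" using c(2) by simp
          finally show "(\<Sum>i<n. c i * fs i x) = 0" .
        qed
      qed
      then show False using c(1) n(3) by blast
    qed
    then show ?thesis using n(1) by simp
  qed
  ultimately have "Sup N = enat m" by (intro antisym Sup_least Sup_upper) auto
  then show ?thesis unfolding alg_mult_def N_def .
qed

context volterra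
begin

lemma Vcoeff_pow_lin:
  "admissible c \<Longrightarrow> admissible e \<Longrightarrow> (Vcoeff ^^ k) (\<lambda>n. a * c n + b * e n) = (\<lambda>n. a * (Vcoeff ^^ k) c n + b * (Vcoeff ^^ k) e n)"
  by (induction k) (simp_all add: Vcoeff_lin admissible_Vcoeff_pow)

lemma Vcoeff_pow_zero: "(Vcoeff ^^ k) (\<lambda>_. 0) = (\<lambda>_. 0)"
proof (induction k)
  case (Suc k)
  have "Vcoeff (\<lambda>_. 0) = (\<lambda>_. 0)" by (auto simp: Vcoeff_def fun_eq_iff split: nat.splits)
  then show ?case using Suc by simp
qed simp

context
  fixes \<mu> z :: complex and m :: nat
  assumes mu: "\<mu> \<noteq> 0" and z_def: "z = 1 / \<mu>" and Dz: "fdet z = 0" and m_def: "m = zero_order fdet z"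
begin

lemma m_props: "0 < m" "(deriv ^^ m) fdet z \<noteq> 0" "\<And>j. j < m \<Longrightarrow> (deriv ^^ j) fdet z = 0"
  using zero_order_props[OF fdet_holomorphic fdet_0, where a = z] Dz unfolding m_def by auto

lemma z_simps: "z \<noteq> 0" "z * \<mu> = 1" "\<mu> * z = 1"
  using mu by (auto simp: z_def)

text \<open>The jets satisfy \<open>(1 - z V) v\<^sub>j = V v\<^sub>j\<^sub>-\<^sub>1\<close> for \<open>j < m\<close>; the powers of \<open>V\<close> turn this into a
  Jordan chain.\<close>
definition chain :: "nat \<Rightarrow> nat \<Rightarrow> complex" where
  "chain j = (Vcoeff ^^ (m - 1 - j)) (jet z j)"

abbreviation chain_fun where "chain_fun j \<equiv> wser (chain j)"

definition shifted :: "(real \<Rightarrow> complex) \<Rightarrow> real \<Rightarrow> complex" where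
  "shifted g = (\<lambda>x. Vphi \<phi> g x - \<mu> * g x)"

lemma admissible_chain: "admissible (chain j)"
  unfolding chain_def by (intro admissible_Vcoeff_pow admissible_jet)

lemma jet_chain:
  assumes "j < m"
  shows "jet z j = (\<lambda>n. z * Vcoeff (jet z j) n + 1 * (if j = 0 then (\<lambda>_. 0) else Vcoeff (jet z (j - 1))) n)"
  using jet_recurrence[of z j] m_props(3)[OF assms] by (auto simp: fun_eq_iff algebra_simps simp del: Vcoeff_simps)

text \<open>The jet relation has \<open>V\<close> in front of the previous jet. Applying
  \<open>V\<close> to the power \<open>m - 1 - j\<close> turns that term into exactly the previous
  chain element, since its exponent is larger by one.\<close>

lemma chain_step:
  assumes "j < m"
  shows "chain j = (\<lambda>n. z * Vcoeff (chain j) n + 1 * (if j = 0 then (\<lambda>_. 0) else chain (j - 1)) n)"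
proof -
  let ?p = "Vcoeff ^^ (m - 1 - j)"
  let ?e = "if j = 0 then (\<lambda>_. 0) else Vcoeff (jet z (j - 1))"
  have e: "admissible ?e" using admissible_Vcoeff[OF admissible_jet] admissible_delta[of 0] by auto
  have "chain j = ?p (\<lambda>n. z * Vcoeff (jet z j) n + 1 * ?e n)"
    unfolding chain_def using jet_chain[OF assms] by (rule arg_cong)
  also have "\<dots> = (\<lambda>n. z * ?p (Vcoeff (jet z j)) n + 1 * ?p ?e n)"
    by (rule Vcoeff_pow_lin[OF admissible_Vcoeff[OF admissible_jet] e])
  also have "?p (Vcoeff (jet z j)) = Vcoeff (chain j)" unfolding chain_def by (rule funpow_swap1[symmetric])
  also have "?p ?e = (if j = 0 then (\<lambda>_. 0) else chain (j - 1))"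
  proof (cases j)
    case (Suc i)
    then have "m - 1 - i = Suc (m - 1 - j)" using assms by simp
    then show ?thesis using Suc by (simp add: chain_def funpow_swap1)
  qed (simp add: Vcoeff_pow_zero)
  finally show ?thesis .
qed

lemma shifted_chain:
  assumes "j < m" "x \<in> {0..1}"
  shows "shifted (chain_fun j) x = - \<mu> * (if j = 0 then 0 else chain_fun (j - 1) x)"
proof -
  let ?e = "if j = 0 then (\<lambda>_. 0) else chain (j - 1)"
  have e: "admissible ?e" using admissible_chain admissible_delta[of 0] by auto
  have "chain_fun j x = wser (\<lambda>n. z * Vcoeff (chain j) n + 1 * ?e n) x"
    using chain_step[OF assms(1)] by metis
  also have "\<dots> = z * Vphi \<phi> (chain_fun j) x + 1 * wser ?e x"
    by (simp only: wser_lin[OF admissible_Vcoeff[OF admissible_chain] e assms(2)] Vphi_wser[OF admissible_chain assms(2)])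
  also have "wser ?e x = (if j = 0 then 0 else chain_fun (j - 1) x)" by (simp add: wser_0)
  finally have *: "\<mu> * chain_fun j x = \<mu> * (z * Vphi \<phi> (chain_fun j) x + 1 * (if j = 0 then 0 else chain_fun (j - 1) x))" by (rule arg_cong)
  have "\<mu> * (z * Vphi \<phi> (chain_fun j) x) = Vphi \<phi> (chain_fun j) x" using z_simps by (simp flip: mult.assoc)
  then show ?thesis using * unfolding shifted_def by (simp add: algebra_simps)
qed

lemma shifted_cong: "(\<And>x. x \<in> {0..1} \<Longrightarrow> f x = g x) \<Longrightarrow> x \<in> {0..1} \<Longrightarrow> shifted f x = shifted g x"
  unfolding shifted_def using Vphi_cong[of f g x] by simp

lemma shifted_pow_cong: "(\<And>x. x \<in> {0..1} \<Longrightarrow> f x = g x) \<Longrightarrow> x \<in> {0..1} \<Longrightarrow> (shifted ^^ k) f x = (shifted ^^ k) g x"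
proof (induction k arbitrary: x)
  case (Suc k)
  have "shifted ((shifted ^^ k) f) x = shifted ((shifted ^^ k) g) x" by (rule shifted_cong) (use Suc in auto)
  then show ?case by simp
qed simp

lemma shifted_pow_scale: "(shifted ^^ k) (\<lambda>x. a * f x) = (\<lambda>x. a * (shifted ^^ k) f x)"
proof (induction k)
  case (Suc k)
  have "shifted (\<lambda>x. a * g x) = (\<lambda>x. a * shifted g x)" for g
    unfolding shifted_def by (simp add: Vphi_scale algebra_simps)
  then show ?case using Suc by simp
qed simp

lemma shifted_pow_chain: "j < m \<Longrightarrow> x \<in> {0..1} \<Longrightarrow> (shifted ^^ Suc j) (chain_fun j) x = 0"
proof (induction j arbitrary: x)
  case 0
  then show ?case using shifted_chain[of 0 x] by simp
next
  case (Suc j)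
  have "(shifted ^^ Suc (Suc j)) (chain_fun (Suc j)) x = (shifted ^^ Suc j) (shifted (chain_fun (Suc j))) x"
    by (simp only: funpow_Suc_right o_apply)
  also have "\<dots> = (shifted ^^ Suc j) (\<lambda>x. - \<mu> * chain_fun j x) x"
    by (rule shifted_pow_cong) (use Suc.prems shifted_chain[of "Suc j"] in auto)
  also have "\<dots> = - \<mu> * (shifted ^^ Suc j) (chain_fun j) x" by (simp only: shifted_pow_scale)
  also have "\<dots> = 0" using Suc by simp
  finally show ?case .
qed

lemma chain_gen_eigenspace: "j < m \<Longrightarrow> chain_fun j \<in> gen_eigenspace \<phi> \<mu>"
  unfolding gen_eigenspace_def shifted_def[abs_def, symmetric]
  using wser_L2[OF admissible_chain, of j] shifted_pow_chain[of j] by (auto simp: ae_eq01_def intro!: exI[of _ "Suc j"] simp del: funpow.simps)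

lemma chain_0: "chain 0 = (\<lambda>n. \<mu> ^ (m - 1) * jet z 0 n)"
proof -
  have "jet z 0 = (\<lambda>n. z * Vcoeff (jet z 0) n)" using jet_chain[OF m_props(1)] by (simp add: fun_eq_iff)
  then have "\<mu> * jet z 0 n = \<mu> * (z * Vcoeff (jet z 0) n)" for n by metis
  then have 1: "Vcoeff (jet z 0) = (\<lambda>n. \<mu> * jet z 0 n)" using z_simps by (simp add: fun_eq_iff flip: mult.assoc)
  have "(Vcoeff ^^ k) (jet z 0) = (\<lambda>n. \<mu> ^ k * jet z 0 n)" for k
  proof (induction k)
    case (Suc k)
    have "Vcoeff (\<lambda>n. \<mu> ^ k * jet z 0 n) = (\<lambda>n. \<mu> ^ k * Vcoeff (jet z 0) n)"
      using Vcoeff_lin[OF admissible_jet[of z 0] admissible_delta[of 0], of "\<mu> ^ k" 0] by simp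
    then show ?case using Suc by (simp only: funpow.simps o_apply 1 power_Suc2 mult.assoc)
  qed simp
  then show ?thesis by (simp add: chain_def)
qed

lemma chain_fun_0: "x \<in> {0..1} \<Longrightarrow> chain_fun 0 x = \<mu> ^ (m - 1) * wser (jet z 0) x"
  using wser_lin[OF admissible_jet[of z 0] admissible_delta[of 0], of x "\<mu> ^ (m - 1)" 0] by (simp add: chain_0)

lemma chain_integrable: "integrable01 (chain_fun j)"
  by (rule wser_integrable[OF admissible_chain])

lemma shifted_sum:
  assumes "n \<le> m" "x \<in> {0..1}"
  shows "shifted (\<lambda>x. \<Sum>j<n. a j * chain_fun j x) x = (\<Sum>j<n. a j * shifted (chain_fun j) x)"
  unfolding shifted_def using Vphi_sum[of n "\<lambda>j. chain_fun j" x a] chain_integrable assms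
  by (simp add: sum_distrib_left sum_subtractf algebra_simps)

lemma shifted_cong_AE:
  assumes "integrable01 f" "integrable01 g" "ae_eq01 f g"
  shows "ae_eq01 (shifted f) (shifted g)"
  using ae_eq01_E[OF assms(3)] unfolding ae_eq01_def
  by eventually_elim (use Vphi_cong_AE[OF assms(1,2) ae_eq01_E[OF assms(3)]] in \<open>auto simp: shifted_def\<close>)

text \<open>Applying \<open>shifted\<close> kills the lowest element and lowers the others by one,
  so induction removes all coefficients but \<open>a 0\<close>. What remains is a multiple of a
  nonzero eigenfunction.\<close>

lemma chain_independent: "n \<le> m \<Longrightarrow> ae_eq01 (\<lambda>x. \<Sum>j<n. a j * chain_fun j x) (\<lambda>_. 0) \<Longrightarrow> j < n \<Longrightarrow> a j = 0"
proof (induction n arbitrary: a j)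
  case (Suc n)
  define C where "C = (\<lambda>x. \<Sum>j<Suc n. a j * chain_fun j x)"
  have C: "integrable01 C" "ae_eq01 C (\<lambda>_. 0)" unfolding C_def
    using Suc.prems by (auto intro!: integrable01_sum chain_integrable simp del: sum.lessThan_Suc)
  have 0: "integrable01 (\<lambda>_. 0)" by (simp add: set_integrable_def)
  have TC: "shifted C x = - \<mu> * (\<Sum>j<n. a (Suc j) * chain_fun j x)" if x: "x \<in> {0..1}" for x
  proof -
    have "shifted C x = (\<Sum>j<Suc n. a j * shifted (chain_fun j) x)" unfolding C_def by (rule shifted_sum[OF Suc.prems(1) x])
    also have "\<dots> = (\<Sum>j<Suc n. a j * (- \<mu> * (if j = 0 then 0 else chain_fun (j - 1) x)))"
      using Suc.prems x by (intro sum.cong refl) (simp only: shifted_chain lessThan_iff)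
    also have "\<dots> = - \<mu> * (\<Sum>j<n. a (Suc j) * chain_fun j x)"
      by (subst sum.lessThan_Suc_shift) (simp add: sum_distrib_left mult_ac)
    finally show ?thesis .
  qed
  have T0: "shifted (\<lambda>_. 0) x = 0" for x by (simp add: shifted_def Vphi_def set_lebesgue_integral_def)
  have "ae_eq01 (\<lambda>x. \<Sum>j<n. a (Suc j) * chain_fun j x) (\<lambda>_. 0)"
    using ae_eq01_E[OF shifted_cong_AE[OF C(1) 0 C(2)]] unfolding ae_eq01_def
    by eventually_elim (use TC T0 mu in auto)
  then have IH: "a (Suc i) = 0" if "i < n" for i using Suc.IH[of "\<lambda>j. a (Suc j)" i] Suc.prems(1) that by simp
  have C0: "C x = a 0 * chain_fun 0 x" for x
    unfolding C_def by (subst sum.lessThan_Suc_shift) (simp add: IH)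
  have "a 0 = 0"
  proof (rule ccontr)
    assume a: "a 0 \<noteq> 0"
    have "AE x in lborel. x \<in> {0..1} \<longrightarrow> wser (jet z 0) x = 0"
      using ae_eq01_E[OF C(2)] by eventually_elim (use a mu chain_fun_0 C0 in auto)
    with eigenfunction_nonzero[OF Dz] show False ..
  qed
  then show ?case using IH Suc.prems(3) by (cases j) auto
qed simp

text \<open>By induction \<open>shifted g\<close> lies in the span of the chain. Correcting
  \<open>g\<close> by chain elements leaves only the top one, whose coefficient must vanish by the
  solvability condition because the derivative of order \<open>m\<close> is nonzero. The corrected
  function is then a multiple of the order-0 jet function.\<close>

lemma gen_eigenspace_span:
  "integrable01 g \<Longrightarrow> ae_eq01 ((shifted ^^ k) g) (\<lambda>_. 0) \<Longrightarrow> \<exists>a. ae_eq01 g (\<lambda>x. \<Sum>j<m. a j * chain_fun j x)"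
proof (induction k arbitrary: g)
  case 0
  then show ?case by (intro exI[of _ "\<lambda>_. 0"]) simp
next
  case (Suc k)
  have Tg: "integrable01 (shifted g)" if "integrable01 g" for g
    unfolding shifted_def using integrable01_lin[OF Vphi_integrable[OF that] that, of 1 "- \<mu>"] by simp
  have "ae_eq01 ((shifted ^^ k) (shifted g)) (\<lambda>_. 0)"
    using Suc.prems(2) by (simp only: funpow_Suc_right o_apply)
  then obtain a where a: "ae_eq01 (shifted g) (\<lambda>x. \<Sum>j<m. a j * chain_fun j x)"
    using Suc.IH[OF Tg[OF Suc.prems(1)]] by blast
  obtain m' where m': "m = Suc m'" using m_props(1) by (cases m) auto
  \<comment> \<open>As \<open>shifted\<close> maps \<open>chain_fun (Suc j)\<close> to
    \<open>- \<mu>\<close> times \<open>chain_fun j\<close> and \<open>z * \<mu> = 1\<close>, adding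
    \<open>z * q\<close> cancels all terms below the top index \<open>m'\<close>.\<close>
  define q where "q = (\<lambda>x. \<Sum>j<m'. a j * chain_fun (Suc j) x)"
  have q: "integrable01 q" unfolding q_def by (intro integrable01_sum chain_integrable)
  define h where "h = (\<lambda>x. 1 * g x + z * q x)"
  have h: "integrable01 h" unfolding h_def by (intro integrable01_lin Suc.prems q)
  have Tq: "shifted q x = - \<mu> * (\<Sum>j<m'. a j * chain_fun j x)" if x: "x \<in> {0..1}" for x
  proof -
    have "shifted q x = (\<Sum>j<m'. a j * shifted (chain_fun (Suc j)) x)"
      unfolding shifted_def q_def using Vphi_sum[of m' "\<lambda>j. chain_fun (Suc j)" x a] chain_integrable x
      by (simp add: sum_distrib_left sum_subtractf algebra_simps)
    also have "\<dots> = (\<Sum>j<m'. a j * (- \<mu> * chain_fun j x))"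
      using shifted_chain[OF _ x] m' by (intro sum.cong refl) simp
    finally show ?thesis by (simp add: sum_distrib_left mult_ac)
  qed
  have "m - 1 - m' = 0" using m' by simp
  then have Yl: "chain_fun m' = wser (jet z m')" by (simp add: chain_def)
  have Th: "ae_eq01 (shifted h) (\<lambda>x. a m' * chain_fun m' x)"
    using ae_eq01_E[OF a] unfolding ae_eq01_def
  proof eventually_elim
    case (elim x)
    show ?case
    proof
      assume x: "x \<in> {0..1}"
      have "shifted h x = shifted g x + z * shifted q x"
        unfolding shifted_def h_def using Vphi_lin[OF Suc.prems(1) q x, of 1 z] by (simp add: algebra_simps)
      also have "z * shifted q x = - (\<Sum>j<m'. a j * chain_fun j x)" unfolding Tq[OF x] using z_simps by (simp flip: mult.assoc)
      also have "shifted g x = (\<Sum>j<m'. a j * chain_fun j x) + a m' * chain_fun m' x" using elim x by (simp add: m')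
      finally show "shifted h x = a m' * chain_fun m' x" by simp
    qed
  qed
  have am: "a m' = 0"
  proof -
    \<comment> \<open>The jet relation contains \<open>V\<close> applied to the previous jet, so the
      equation for \<open>h\<close> is first hit with \<open>V\<close>. Adding
      \<open>z * a m'\<close> times the jet function of order \<open>m\<close> then cancels
      everything except the constant \<open>\<kappa>\<close>, a nonzero multiple of
      \<open>a m'\<close>.\<close>
    define v where "v = Vphi \<phi> h"
    have v: "integrable01 v" unfolding v_def by (rule Vphi_integrable[OF h])
    define c where "c = wser (jet z m)"
    have c: "integrable01 c" unfolding c_def by (rule wser_integrable[OF admissible_jet])
    define \<kappa> where "\<kappa> = z * a m' * ((deriv ^^ m) fdet z / fact m)"
    have Tv: "v x - z * Vphi \<phi> v x = - z * a m' * wser (Vcoeff (jet z m')) x" if x: "x \<in> {0..1}" for x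
    proof -
      have "Vphi \<phi> (shifted h) x = Vphi \<phi> (\<lambda>x. a m' * chain_fun m' x) x"
        by (rule Vphi_cong_AE[OF Tg[OF h] set_integrable_mult_right[OF chain_integrable] ae_eq01_E[OF Th] x])
      also have "\<dots> = a m' * wser (Vcoeff (jet z m')) x" by (simp only: Vphi_scale Yl Vphi_wser[OF admissible_jet x])
      finally have "Vphi \<phi> (shifted h) x = a m' * wser (Vcoeff (jet z m')) x" .
      moreover have "Vphi \<phi> (shifted h) x = Vphi \<phi> v x - \<mu> * v x"
        unfolding shifted_def using Vphi_lin[OF Vphi_integrable[OF h] h x, of 1 "- \<mu>"] by (simp add: v_def)
      ultimately have "z * (Vphi \<phi> v x - \<mu> * v x) = z * (a m' * wser (Vcoeff (jet z m')) x)" by simp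
      moreover have "z * (\<mu> * v x) = v x" using z_simps by (simp flip: mult.assoc)
      ultimately show ?thesis by (simp add: algebra_simps)
    qed
    define f where "f = (\<lambda>x. 1 * v x + (z * a m') * c x)"
    have "f x - z * Vphi \<phi> f x = \<kappa>" if x: "x \<in> {0..1}" for x
    proof -
      have "f x - z * Vphi \<phi> f x = (v x - z * Vphi \<phi> v x) + z * a m' * (c x - z * Vphi \<phi> c x)"
        unfolding f_def Vphi_lin[OF v c x, of 1 "z * a m'"] by (simp add: algebra_simps)
      also have "c x - z * Vphi \<phi> c x = (deriv ^^ m) fdet z / fact m + wser (Vcoeff (jet z m')) x"
        using wser_jet[OF x, of z m] Vphi_wser[OF admissible_jet x, of z m] m' by (simp add: c_def algebra_simps)
      finally show ?thesis unfolding Tv[OF x] by (simp add: \<kappa>_def algebra_simps)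
    qed
    then have "AE x in lborel. x \<in> {0..1} \<longrightarrow> f x - z * Vphi \<phi> f x = \<kappa>" by simp
    moreover have "integrable01 f" unfolding f_def by (intro integrable01_lin v c)
    ultimately have "\<kappa> = 0" using resolvent_integral[of f z \<kappa>] Dz by simp
    then show ?thesis unfolding \<kappa>_def using z_simps(1) m_props(2) by simp
  qed
  have "AE x in lborel. x \<in> {0..1} \<longrightarrow> h x - z * Vphi \<phi> h x = 0"
    using ae_eq01_E[OF Th]
  proof eventually_elim
    case (elim x)
    show ?case
    proof
      assume "x \<in> {0..1}"
      then have "Vphi \<phi> h x = \<mu> * h x" using elim am by (simp add: shifted_def)
      then show "h x - z * Vphi \<phi> h x = 0" using z_simps by (simp flip: mult.assoc)
    qed
  qed
  from resolvent_unique[OF h this] obtain K where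
    K: "AE x in lborel. x \<in> {0..1} \<longrightarrow> h x = K * wser (jet z 0) x" by blast
  \<comment> \<open>The power of \<open>z\<close> undoes the factor \<open>\<mu> ^ (m - 1)\<close>
    in \<open>chain_fun 0\<close>; the other entries move \<open>z * q\<close> to the right-hand
    side.\<close>
  define b where "b = (\<lambda>j. if j = 0 then K * z ^ m' else - z * a (j - 1))"
  have "ae_eq01 g (\<lambda>x. \<Sum>j<m. b j * chain_fun j x)"
    using K unfolding ae_eq01_def
  proof eventually_elim
    case (elim x)
    show ?case
    proof
      assume x: "x \<in> {0..1}"
      have "z ^ m' * chain_fun 0 x = wser (jet z 0) x"
      proof -
        have "z ^ m' * chain_fun 0 x = (z * \<mu>) ^ m' * wser (jet z 0) x"
          unfolding chain_fun_0[OF x] by (simp add: m' power_mult_distrib mult_ac)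
        then show ?thesis using z_simps by simp
      qed
      then have "b 0 * chain_fun 0 x = h x" using elim x by (simp add: b_def mult.assoc)
      moreover have "(\<Sum>j<m'. b (Suc j) * chain_fun (Suc j) x) = - z * q x"
        by (simp add: b_def q_def sum_distrib_left mult_ac)
      ultimately show "g x = (\<Sum>j<m. b j * chain_fun j x)"
        unfolding m' sum.lessThan_Suc_shift by (simp add: h_def)
    qed
  qed
  then show ?case by blast
qed

lemma alg_mult_eq_zero_order: "alg_mult \<phi> \<mu> = enat m"
proof (rule alg_mult_eqI)
  fix f assume "f \<in> gen_eigenspace \<phi> \<mu>"
  then obtain k where "f \<in> L2_01" "ae_eq01 ((shifted ^^ k) f) (\<lambda>_. 0)"
    unfolding gen_eigenspace_def shifted_def[abs_def, symmetric] by blast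
  then show "\<exists>a. ae_eq01 f (\<lambda>x. \<Sum>j<m. a j * chain_fun j x)" by (intro gen_eigenspace_span L2_01_integrable)
qed (use chain_gen_eigenspace chain_independent[of m] in auto)

end

end

theorem theorem4p8:
  fixes \<phi> :: "real \<Rightarrow> real"
  assumes "\<forall>x\<in>{0..1}. \<phi> x \<in> {0..1}"
    and "mono_on {0..1} \<phi>"
    and "continuous_on {0..1} \<phi>"
    and "\<forall>x\<in>{0<..<1}. \<phi> x > x"
    and "\<phi> 0 = 0 \<or> (\<forall>\<epsilon>\<in>{0<..<1}. \<phi> (1 - \<epsilon>) \<noteq> 1)"
  shows "infinite (nonzero_eigs \<phi>) \<and>
         (\<forall>\<mu>\<in>nonzero_eigs \<phi>. alg_mult \<phi> \<mu> < \<infinity>) \<and>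
         (\<exists>lam. eig_enum \<phi> lam) \<and>
         (\<forall>lam. eig_enum \<phi> lam \<longrightarrow>
            (\<forall>\<epsilon>>0. finite {n. \<epsilon> < cmod (lam n)}) \<and>
            ((\<lambda>\<epsilon>. \<Sum>n\<in>{n. \<epsilon> < cmod (lam n)}. lam n) \<longlongrightarrow> 1) (at_right 0) \<and>
            (\<forall>\<epsilon>>0. summable (\<lambda>n. cmod (lam n) powr (1 + \<epsilon>))))"
proof -
  interpret volterra \<phi> by unfold_locales (use assms(1-4) in auto)
  note fdet = fdet_holomorphic fdet_0
  have mult: "alg_mult \<phi> \<mu> = enat (zero_order fdet (1 / \<mu>))" "0 < zero_order fdet (1 / \<mu>)"
    if "\<mu> \<in> nonzero_eigs \<phi>" for \<mu>
    using that alg_mult_eq_zero_order zero_order_props(3)[OF fdet] unfolding nonzero_eigs_eq by auto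
  have "(deriv ^^ n) fdet 0 \<noteq> 0" for n
    unfolding fdet_deriv_at_0 using fcoeff_pos[OF assms(5), of n] by simp
  then have "infinite {a. fdet a = 0}" by (intro infinite_zeros fdet fdet_growth)
  \<comment> \<open>No zero is at the origin because \<open>fdet 0 = 1\<close>, so infinitely many
    zeros yield infinitely many eigenvalues.\<close>
  moreover have "{a. fdet a = 0} \<subseteq> (\<lambda>\<mu>. 1 / \<mu>) ` nonzero_eigs \<phi>"
    unfolding nonzero_eigs_eq using fdet_0 by (auto intro!: image_eqI[where x = "1 / _"])
  ultimately have inf: "infinite (nonzero_eigs \<phi>)" by (meson finite_imageI finite_subset)
  have "countable (nonzero_eigs \<phi>)"
    unfolding nonzero_eigs_eq by (rule countable_reciprocal_zeros[OF fdet])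
  then obtain lam where "range lam = nonzero_eigs \<phi>"
    "\<forall>\<mu>\<in>nonzero_eigs \<phi>. finite {n::nat. lam n = \<mu>} \<and> card {n. lam n = \<mu>} = zero_order fdet (1 / \<mu>)"
    using ex_enum_with_multiplicity[OF _ inf, of "\<lambda>\<mu>. zero_order fdet (1 / \<mu>)"] mult(2) by blast
  then have "eig_enum \<phi> lam" unfolding eig_enum_def using mult(1) by simp
  moreover have "(\<forall>\<epsilon>>0. finite {n. \<epsilon> < cmod (lam n)}) \<and>
      ((\<lambda>\<epsilon>. \<Sum>n\<in>{n. \<epsilon> < cmod (lam n)}. lam n) \<longlongrightarrow> 1) (at_right 0) \<and>
      (\<forall>\<epsilon>>0. summable (\<lambda>n. cmod (lam n) powr (1 + \<epsilon>)))" if "eig_enum \<phi> lam" for lam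
  proof -
    have ran: "range lam = {\<mu>. \<mu> \<noteq> 0 \<and> fdet (1 / \<mu>) = 0}"
      using that unfolding eig_enum_def nonzero_eigs_eq by simp
    have m: "finite {n. lam n = \<mu>} \<and> card {n. lam n = \<mu>} = zero_order fdet (1 / \<mu>)" if "\<mu> \<in> range lam" for \<mu>
      using \<open>eig_enum \<phi> lam\<close> that mult(1)[of \<mu>] unfolding eig_enum_def by auto
    show ?thesis
      \<comment> \<open>The limit is \<open>- deriv fdet 0\<close>, that is \<open>fcoeff 1\<close>,
        the length of the interval.\<close>
      using reciprocal_zeros_enum[OF fdet fdet_growth ran m] by (simp add: fdet_deriv_one)
  qed
  ultimately show ?thesis using inf mult(1) by auto
qed

end
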